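(* The \textsc{Lcp} problem (Alice holds a string $A$, Bob holds a string $B$, and they must determine $\ell=\mathrm{LCP}(A,B)$) has a randomized public-coin protocol with either (1) $O(\lg z+\lg\lg \ell)$ rounds and $O(\lg \ell)$ communication, or (2) $O(\lg z)$ rounds and $O(\lg \ell+\lg\lg\lg |A|)$ communication. Here $\ell$ is the length of the longest common prefix of $A$ and $B$, and $z$ is the number of phrases in the self-referential LZ77 parse of this prefix.
   Context: Strings are over a finite alphabet $\Sigma$ known to both parties. For strings $X,Y$, $\mathrm{LCP}(X,Y)$ is the largest $\ell\ge0$ with $X[1..\ell]=Y[1..\ell]$. The (self-referential) LZ77 parse of a string $S$ divides $S$ greedily from left to right into phrases $f_1\cdots f_z$: the $i$-th phrase, starting at position $u_i$, is the longest substring having an occurrence (its source) starting at some position $s_i<u_i$, followed by the next symbol. The source is allowed to overlap the phrase itself. The phrase is represented by $(s_i,l_i,\alpha_i)$: source start, length, and the symbol at $u_i+l_i$. A fixed deterministic rule (e.g. leftmost source) makes the parse unique. In the public-coin randomized model the parties share an infinite string of independent unbiased random bits, and the output must be correct on every input with probability at least a fixed constant greater than $1/2$. A round is one message; communication is the total number of bits sent. *)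

theory Defs
  imports "HOL-Probability.Probability"
begin

definition lcp :: "'a list \<Rightarrow> 'a list \<Rightarrow> nat" where
  "lcp X Y = (GREATEST l. l \<le> length X \<and> l \<le> length Y \<and> take l X = take l Y)"

text \<open>Length of the copied part of the LZ77 phrase starting at position u:
  the longest L such that S[u..u+L) has an occurrence starting at some s < u
  (possibly overlapping the phrase) and is followed by a next symbol S[u+L].
  L = 0 is always allowed (a literal phrase).\<close>
definition lz_copy_len :: "'a list \<Rightarrow> nat \<Rightarrow> nat" where
  "lz_copy_len S u = (GREATEST L. L < length S - u \<and>
      (L = 0 \<or> (\<exists>s<u. \<forall>i<L. S ! (s + i) = S ! (u + i))))"

function lz_phrases_from :: "'a list \<Rightarrow> nat \<Rightarrow> nat" where
  "lz_phrases_from S u =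
     (if u < length S then Suc (lz_phrases_from S (u + lz_copy_len S u + 1)) else 0)"
  by pat_completeness auto
termination
  by (relation "Wellfounded.measure (\<lambda>(S, u). length S - u)") auto

definition lz77_num_phrases :: "'a list \<Rightarrow> nat" where
  "lz77_num_phrases S = lz_phrases_from S 0"

text \<open>A (public-coin, randomized) protocol in the standard bit-by-bit model.
  The shared random string is r :: nat \<Rightarrow> bool.  Given the bits exchanged so far
  (the transcript) and r, both parties know whether the protocol has halted and who
  speaks next; the speaker sends one bit depending on its own input, r and the
  transcript.  A round (message) is a maximal block of consecutive bits sent by the
  same party.  The output is a function of the final transcript and r, so both parties
  learn it.\<close>
record 'a protocol =
  halts :: "bool list \<Rightarrow> (nat \<Rightarrow> bool) \<Rightarrow> bool"
  alice_speaks :: "bool list \<Rightarrow> (nat \<Rightarrow> bool) \<Rightarrow> bool"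
  bit_alice :: "'a list \<Rightarrow> (nat \<Rightarrow> bool) \<Rightarrow> bool list \<Rightarrow> bool"
  bit_bob :: "'a list \<Rightarrow> (nat \<Rightarrow> bool) \<Rightarrow> bool list \<Rightarrow> bool"
  prot_output :: "bool list \<Rightarrow> (nat \<Rightarrow> bool) \<Rightarrow> nat"

fun run :: "'a protocol \<Rightarrow> 'a list \<Rightarrow> 'a list \<Rightarrow> (nat \<Rightarrow> bool) \<Rightarrow> nat \<Rightarrow> bool list" where
  "run P A B r 0 = []"
| "run P A B r (Suc k) =
     (let t = run P A B r k in
      if halts P t r then t
      else t @ [if alice_speaks P t r then bit_alice P A r t else bit_bob P B r t])"

definition num_rounds :: "'a protocol \<Rightarrow> (nat \<Rightarrow> bool) \<Rightarrow> bool list \<Rightarrow> nat" where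
  "num_rounds P r t = length (remdups_adj (map (\<lambda>i. alice_speaks P (take i t) r) [0..<length t]))"

definition run_ok :: "'a protocol \<Rightarrow> 'a list \<Rightarrow> 'a list \<Rightarrow> (nat \<Rightarrow> bool) \<Rightarrow> real \<Rightarrow> real \<Rightarrow> nat \<Rightarrow> bool" where
  "run_ok P A B r R c v = (\<exists>k. let t = run P A B r k in
       halts P t r \<and> real (num_rounds P r t) \<le> R \<and> real (length t) \<le> c \<and> prot_output P t r = v)"

definition coins :: "(nat \<Rightarrow> bool) measure" where
  "coins = PiM UNIV (\<lambda>_::nat. measure_pmf (pmf_of_set (UNIV :: bool set)))"

end

theory Submission
  imports Defs "HOL-Library.Log_Nat"
begin

text \<open>Phrases that end within the longest common prefix are the same in the parses of \<open>A\<close> and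
  \<open>B\<close>, so the prefixes of \<open>A\<close> and \<open>B\<close> at the starts of their \<open>i\<close>-th phrases agree up to an index
  \<open>q \<in> {z, z + 1}\<close> (after adding a sentinel) and disagree from then on.  A power of two above \<open>q\<close>
  is found by repeated doubling, and \<open>q\<close> itself by a binary search; all comparisons use hashes of
  constant length.  Unequal hashes are always right, so a wrong turn is
  noticed by testing the lower end of the current interval again, and backtracking is a random
  walk with drift towards \<open>q\<close>; \<open>O(lg z)\<close> steps of constantly many bits suffice.

  Now Alice's source for her phrase number \<open>q\<close> fixes an infinite string which both inputs follow
  for a while after their last common phrase start, and the longest common prefix is determined
  by the shorter of the two matches.  To let the right party announce its match length within
  \<open>O(lg l)\<close> bits it suffices to compare the iterated logarithms of the match lengths, either in
  unary (\<open>O(lg lg l)\<close> rounds) or by sending Alice's value (\<open>O(lg lg lg |A|)\<close> bits).\<close>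

section \<open>Protocol trees and their bitwise execution\<close>

fun code :: "nat \<Rightarrow> bool list" where
  "code n = (if n = 0 then [False] else True # odd n # code (n div 2))"

declare code.simps [simp del]

lemma code_0: "code 0 = [False]"
  by (subst code.simps) simp

lemma code_pos: "0 < n \<Longrightarrow> code n = True # odd n # code (n div 2)"
  by (subst code.simps) simp

lemma length_code: "length (code n) = 2 * floorlog 2 n + 1"
proof (induction n rule: code.induct)
  case (1 n)
  show ?case
  proof (cases "n = 0")
    case True
    then show ?thesis by (simp add: code_0 floorlog_def)
  next
    case False
    then show ?thesis
      using 1 compute_floorlog[of 2 n] by (simp add: code_pos)
  qed
qed

text \<open>Each binary digit, least significant first, is preceded by \<open>True\<close>, and
  \<open>False\<close> marks the end. A reader thus knows when a word is complete, and the code is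
  prefix-free.\<close>

lemma code_append_eqD: "code m @ xs = code n @ ys \<Longrightarrow> m = n \<and> xs = ys"
proof (induction m arbitrary: n rule: code.induct)
  case (1 m)
  show ?case
  proof (cases "m = 0 \<or> n = 0")
    case True
    then show ?thesis using "1.prems" by (cases "m = 0"; cases "n = 0") (simp_all add: code_0 code_pos)
  next
    case False
    then have eq: "odd m = odd n" "code (m div 2) @ xs = code (n div 2) @ ys"
      using "1.prems" by (simp_all add: code_pos)
    then have "m div 2 = n div 2" "xs = ys"
      using "1.IH"[of "n div 2"] False by auto
    moreover have "m mod 2 = n mod 2" using eq(1) by presburger
    ultimately show ?thesis by (metis div_mult_mod_eq)
  qed
qed

lemma inj_code: "inj code"
proof (rule injI)
  fix m n assume "code m = code n"
  then show "m = n" using code_append_eqD[of m "[]" n "[]"] by simp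
qed

lemma take_code_notin_range:
  assumes "i < length (code m)" shows "take i (code m) \<notin> range code"
proof
  assume "take i (code m) \<in> range code"
  then obtain n where n: "take i (code m) = code n" by auto
  have "code m @ [] = code n @ drop i (code m)"
    using n append_take_drop_id[of i "code m"] by simp
  then have "[] = drop i (code m)" using code_append_eqD by blast
  then show False using assms by simp
qed

text \<open>The coins influence the contents of the messages but not the shape of the tree: which
  player speaks and where the protocol stops depends on the transcript alone.  Each message
  looks at finitely many coins, so measurability comes for free.\<close>
codatatype 'a ptree =
    Output nat
  | Message bool "'a list \<Rightarrow> nat list" "'a list \<Rightarrow> bool list \<Rightarrow> nat" "nat \<Rightarrow> 'a ptree"

definition party :: "bool \<Rightarrow> 'b \<Rightarrow> 'b \<Rightarrow> 'b" where
  "party w a b = (if w then a else b)"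

lemma party_simps [simp]: "party True a b = a" "party False a b = b"
  by (simp_all add: party_def)

text \<open>\<open>R\<close> and \<open>c\<close> are upper bounds: an output node accepts any
  values, and each message costs a round even if the same party spoke just before.\<close>

inductive exec :: "(nat \<Rightarrow> bool) \<Rightarrow> 'a list \<Rightarrow> 'a list \<Rightarrow> 'a ptree \<Rightarrow> nat \<Rightarrow> nat \<Rightarrow> nat \<Rightarrow> bool"
  for r A B where
  exec_Output: "exec r A B (Output v) R c v"
| exec_Message:
    "\<lbrakk> m = g (party w A B) (map r (J (party w A B))); length (code m) \<le> d; exec r A B (k m) R c v \<rbrakk>
     \<Longrightarrow> exec r A B (Message w J g k) (Suc R) (d + c) v"

section \<open>Bitwise execution of a protocol tree\<close>

fun feed :: "'a ptree \<times> bool list \<Rightarrow> bool \<Rightarrow> 'a ptree \<times> bool list" where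
  "feed (Output v, buf) b = (Output v, buf)"
| "feed (Message w J g k, buf) b =
     (let buf' = buf @ [b] in
      if buf' \<in> range code then (k (inv code buf'), []) else (Message w J g k, buf'))"

definition config :: "'a ptree \<Rightarrow> bool list \<Rightarrow> 'a ptree \<times> bool list" where
  "config T t = foldl feed (T, []) t"

lemma config_Nil: "config T [] = (T, [])"
  by (simp add: config_def)

lemma config_snoc: "config T (t @ [b]) = feed (config T t) b"
  by (simp add: config_def)

definition next_bit :: "'a ptree \<times> bool list \<Rightarrow> (nat \<Rightarrow> bool) \<Rightarrow> 'a list \<Rightarrow> bool" where
  "next_bit s r X = (case s of (Output _, _) \<Rightarrow> False
     | (Message w J g k, buf) \<Rightarrow> code (g X (map r (J X))) ! length buf)"

definition compile :: "'a ptree \<Rightarrow> 'a protocol" where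
  "compile T = \<lparr>
     halts = \<lambda>t _. case fst (config T t) of Output _ \<Rightarrow> True | _ \<Rightarrow> False,
     alice_speaks = \<lambda>t _. case fst (config T t) of Output _ \<Rightarrow> True | Message w _ _ _ \<Rightarrow> w,
     bit_alice = \<lambda>A r t. next_bit (config T t) r A,
     bit_bob = \<lambda>B r t. next_bit (config T t) r B,
     prot_output = \<lambda>t _. case fst (config T t) of Output v \<Rightarrow> v | _ \<Rightarrow> 0\<rparr>"

lemma run_Suc_Message:
  fixes r :: "nat \<Rightarrow> bool"
  assumes "run (compile T) A B r j = t" "config T t = (Message w J g k, buf)"
    and "m = g (party w A B) (map r (J (party w A B)))"
  shows "run (compile T) A B r (Suc j) = t @ [code m ! length buf]"
  using assms by (cases w) (simp_all add: compile_def next_bit_def Let_def)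

text \<open>No proper prefix of a code word is a code word, so the decoder stays at its node until
  the last bit, and the length of its buffer tells the sender which bit comes next.\<close>

lemma config_run_partial:
  fixes r :: "nat \<Rightarrow> bool"
  assumes T: "config T t = (Message w J g k, [])" and run: "run (compile T) A B r j = t"
    and m: "m = g (party w A B) (map r (J (party w A B)))" and i: "i < length (code m)"
  shows "run (compile T) A B r (j + i) = t @ take i (code m) \<and>
         config T (t @ take i (code m)) = (Message w J g k, take i (code m))"
  using i
proof (induction i)
  case 0
  then show ?case using T run by simp
next
  case (Suc i)
  then have IH: "run (compile T) A B r (j + i) = t @ take i (code m)"
    "config T (t @ take i (code m)) = (Message w J g k, take i (code m))" by auto
  have tk: "take (Suc i) (code m) = take i (code m) @ [code m ! i]"
    using Suc.prems by (simp add: take_Suc_conv_app_nth)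
  have "run (compile T) A B r (Suc (j + i)) = t @ take (Suc i) (code m)"
    using run_Suc_Message[OF IH m] Suc.prems by (simp add: tk)
  moreover have "config T (t @ take (Suc i) (code m)) = (Message w J g k, take (Suc i) (code m))"
    using take_code_notin_range[OF Suc.prems] unfolding tk append_assoc[symmetric] config_snoc IH(2)
    by (simp add: tk)
  ultimately show ?case by simp
qed

lemma config_run_message:
  fixes r :: "nat \<Rightarrow> bool"
  assumes T: "config T t = (Message w J g k, [])" and run: "run (compile T) A B r j = t"
    and m: "m = g (party w A B) (map r (J (party w A B)))"
  shows "run (compile T) A B r (j + length (code m)) = t @ code m"
    and "config T (t @ code m) = (k m, [])"
proof -
  define i where "i = length (code m) - 1"
  have i: "i < length (code m)" "Suc i = length (code m)"
    by (simp_all add: i_def length_code)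
  note IH = config_run_partial[OF T run m i(1)]
  have tk: "code m = take i (code m) @ [code m ! i]"
    using i by (metis order_refl take_Suc_conv_app_nth take_all)
  have "run (compile T) A B r (Suc (j + i)) = t @ code m"
    using run_Suc_Message[OF IH[THEN conjunct1] IH[THEN conjunct2] m] i
    by (simp add: tk[symmetric])
  then show "run (compile T) A B r (j + length (code m)) = t @ code m"
    using i by (metis add_Suc_right)
  have "config T (t @ code m) = feed (Message w J g k, take i (code m)) (code m ! i)"
    by (subst tk) (simp only: append_assoc[symmetric] config_snoc IH)
  also have "\<dots> = (k m, [])"
    by (simp add: tk[symmetric] inj_code)
  finally show "config T (t @ code m) = (k m, [])" .
qed

definition speakers :: "'a protocol \<Rightarrow> (nat \<Rightarrow> bool) \<Rightarrow> bool list \<Rightarrow> bool list" where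
  "speakers P r t = map (\<lambda>i. alice_speaks P (take i t) r) [0..<length t]"

lemma speakers_message:
  assumes T: "config T t = (Message w J g k, [])" and run: "run (compile T) A B r j = t"
    and m: "m = g (party w A B) (map r (J (party w A B)))"
  shows "speakers (compile T) r (t @ code m) =
         speakers (compile T) r t @ replicate (length (code m)) w"
proof (rule nth_equalityI)
  fix i assume "i < length (speakers (compile T) r (t @ code m))"
  then have i: "i < length t + length (code m)" by (simp add: speakers_def)
  show "speakers (compile T) r (t @ code m) ! i =
        (speakers (compile T) r t @ replicate (length (code m)) w) ! i"
  proof (cases "i < length t")
    case True
    then show ?thesis by (simp add: speakers_def nth_append)
  next
    case False
    then have "config T (t @ take (i - length t) (code m)) =
               (Message w J g k, take (i - length t) (code m))"
      using config_run_partial[OF T run m] i by auto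
    then show ?thesis using False i
      by (simp add: speakers_def nth_append compile_def)
  qed
qed (simp add: speakers_def)

lemma length_remdups_adj_append:
  "length (remdups_adj (xs @ ys)) \<le> length (remdups_adj xs) + length (remdups_adj ys)"
proof (induction xs rule: remdups_adj.induct)
  case (2 x)
  then show ?case by (simp add: remdups_adj_Cons split: list.split)
qed auto

text \<open>A message appends a constant block to the list of speakers and hence at most one new run
  of equal entries.\<close>

lemma exec_imp_run:
  assumes "exec r A B T' R c v" and "config T t = (T', [])" and "run (compile T) A B r j = t"
  shows "\<exists>t'. run (compile T) A B r (j + length t') = t @ t' \<and> length t' \<le> c \<and>
              config T (t @ t') = (Output v, []) \<and>
              length (remdups_adj (speakers (compile T) r (t @ t'))) \<le>
              length (remdups_adj (speakers (compile T) r t)) + R"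
  using assms
proof (induction arbitrary: t j)
  case (exec_Output v)
  then show ?case by (intro exI[of _ "[]"]) simp
next
  case (exec_Message m g w J d k R c v)
  note step = config_run_message[OF exec_Message.prems exec_Message.hyps(1)]
  obtain t' where t': "run (compile T) A B r (j + length (code m) + length t') = (t @ code m) @ t'"
    "length t' \<le> c" "config T ((t @ code m) @ t') = (Output v, [])"
    "length (remdups_adj (speakers (compile T) r ((t @ code m) @ t'))) \<le>
     length (remdups_adj (speakers (compile T) r (t @ code m))) + R"
    using exec_Message.IH[OF step(2,1)] by blast
  have "length (remdups_adj (speakers (compile T) r (t @ code m))) \<le>
        length (remdups_adj (speakers (compile T) r t)) + 1"
    unfolding speakers_message[OF exec_Message.prems exec_Message.hyps(1)]
    by (rule order.trans[OF length_remdups_adj_append]) (simp add: remdups_adj_replicate)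
  then show ?case using t' exec_Message.hyps(2)
    by (intro exI[of _ "code m @ t'"]) (simp add: add.assoc)
qed

lemma run_ok_compile:
  assumes "exec r A B T R c v" "real R \<le> R'" "real c \<le> c'"
  shows "run_ok (compile T) A B r R' c' v"
proof -
  obtain t where "run (compile T) A B r (length t) = t" "length t \<le> c" "config T t = (Output v, [])"
    "length (remdups_adj (speakers (compile T) r t)) \<le> R"
    using exec_imp_run[OF assms(1) config_Nil, of 0] by (auto simp: speakers_def)
  then show ?thesis
    using assms(2,3) unfolding run_ok_def num_rounds_def speakers_def
    by (intro exI[of _ "length t"]) (auto simp: compile_def)
qed

section \<open>Measurability of the success event\<close>

lemma space_coins [simp]: "space coins = UNIV"
  by (simp add: coins_def space_PiM)

lemma coin_measurable [measurable]: "(\<lambda>r. r i) \<in> measurable coins (count_space UNIV)"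
proof -
  have "(\<lambda>r. r i) \<in> measurable coins (measure_pmf (pmf_of_set (UNIV :: bool set)))"
    unfolding coins_def by (rule measurable_component_singleton) simp
  then show ?thesis by (simp cong: measurable_cong_sets)
qed

lemma coins_measurable [measurable]: "(\<lambda>r. map r xs) \<in> measurable coins (count_space UNIV)"
proof (induction xs)
  case (Cons x xs)
  note [measurable] = Cons
  have "(\<lambda>r. r x # map r xs) \<in> measurable coins (count_space UNIV)" by measurable
  then show ?case by simp
qed simp

lemma next_bit_measurable: "(\<lambda>r. next_bit s r X) \<in> measurable coins (count_space UNIV)"
proof (cases s)
  case (Pair T buf)
  show ?thesis
  proof (cases T)
    case (Message w J g k)
    have "(\<lambda>r. code (g X (map r (J X))) ! length buf) \<in> measurable coins (count_space UNIV)"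
      by measurable
    then show ?thesis using Pair Message by (simp add: next_bit_def)
  qed (simp add: Pair next_bit_def)
qed

text \<open>There are countably many transcripts, and the extension of a fixed one depends on
  finitely many coins.\<close>

lemma run_measurable: "(\<lambda>r. run (compile T) A B r k) \<in> measurable coins (count_space UNIV)"
proof (induction k)
  case (Suc k)
  define extend where "extend t r = (if halts (compile T) t r then t
      else t @ [if alice_speaks (compile T) t r then bit_alice (compile T) A r t
                else bit_bob (compile T) B r t])" for t r
  have snoc: "(\<lambda>r. t @ [next_bit s r X]) \<in> measurable coins (count_space UNIV)" for t s X
    by (rule measurable_compose[OF next_bit_measurable]) simp
  have "extend t \<in> measurable coins (count_space UNIV)" for t
    using snoc[of t "config T t" A] snoc[of t "config T t" B] unfolding extend_def compile_def
    by (cases "fst (config T t)"; cases "alice_speaks (compile T) t undefined")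
       (simp_all add: compile_def)
  then have "(\<lambda>r. extend (run (compile T) A B r k) r) \<in> measurable coins (count_space UNIV)"
    by (rule measurable_compose_countable) (rule Suc)
  then show ?case by (simp add: extend_def Let_def)
qed simp

lemma run_ok_measurable: "{r \<in> space coins. run_ok (compile T) A B r R c v} \<in> sets coins"
proof -
  \<comment> \<open>In a compiled protocol halting, speaker and output ignore the coins, so a dummy
    coin sequence can be used to judge a transcript.\<close>
  define good where "good t = (let P = compile T; r = (\<lambda>_. False) in halts P t r \<and>
     real (num_rounds P r t) \<le> R \<and> real (length t) \<le> c \<and> prot_output P t r = v)" for t
  have "run_ok (compile T) A B r R c v = (\<exists>k. good (run (compile T) A B r k))" for r
    by (simp add: run_ok_def good_def Let_def compile_def num_rounds_def)
  moreover have "Measurable.pred coins (\<lambda>r. \<exists>k. good (run (compile T) A B r k))"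
    using run_measurable by measurable
  ultimately show ?thesis by (simp add: pred_def)
qed

section \<open>Hash collisions\<close>

interpretation coins: prob_space coins
  unfolding coins_def by (rule prob_space_PiM) (rule prob_space_measure_pmf)

lemma coins_cylinder:
  assumes "finite J"
  shows "measure coins {r. \<forall>j\<in>J. r j = v j} = (1/2) ^ card J"
proof -
  define M where "M = (\<lambda>_::nat. measure_pmf (pmf_of_set (UNIV :: bool set)))"
  have emb: "prod_emb UNIV M J (PiE J (\<lambda>j. {v j})) = {r. \<forall>j\<in>J. r j = v j}"
  proof (rule set_eqI)
    fix r :: "nat \<Rightarrow> bool"
    have "restrict r J \<in> PiE J (\<lambda>j. {v j}) \<longleftrightarrow> (\<forall>j\<in>J. r j = v j)"
      by (simp add: restrict_PiE_iff Pi_iff)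
    then show "r \<in> prod_emb UNIV M J (PiE J (\<lambda>j. {v j})) \<longleftrightarrow> r \<in> {r. \<forall>j\<in>J. r j = v j}"
      by (simp add: prod_emb_def M_def PiE_UNIV_domain)
  qed
  interpret product_prob_space M UNIV
    by (rule product_prob_spaceI) (simp add: M_def prob_space_measure_pmf)
  have "measure (PiM UNIV M) (prod_emb UNIV M J (PiE J (\<lambda>j. {v j}))) =
        (\<Prod>j\<in>J. measure (M j) {v j})"
    by (rule measure_PiM_emb) (use assms in \<open>auto simp: M_def\<close>)
  also have "\<dots> = (1/2) ^ card J"
    by (simp add: M_def measure_pmf_single UNIV_bool)
  also have "prod_emb UNIV M J (PiE J (\<lambda>j. {v j})) = {r. \<forall>j\<in>J. r j = v j}"
    by (rule emb)
  finally show ?thesis by (simp add: coins_def M_def)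
qed

lemma coin_eq_sets: "{r. r i = b} \<in> sets coins"
proof -
  have "Measurable.pred coins (\<lambda>r. r i = b)" by measurable
  then show ?thesis by (simp add: pred_def)
qed

text \<open>The event is covered by one cylinder for each choice \<open>w\<close> of the common
  values: \<open>2 ^ card K\<close> cylinders, each fixing \<open>2 * card K\<close> distinct coins
  and so of measure \<open>(1/4) ^ card K\<close>.\<close>

lemma coins_agree_on_pairs:
  assumes fin: "finite K" and inj: "inj_on f K" "inj_on g K" and disj: "f ` K \<inter> g ` K = {}"
  shows "measure coins {r. \<forall>k\<in>K. r (f k) = r (g k)} \<le> (1/2) ^ card K"
proof -
  define val where "val w j = (if j \<in> f ` K then w (inv_into K f j) else w (inv_into K g j))"
    for w :: "'a \<Rightarrow> bool" and j
  define cyl where "cyl w = {r. \<forall>j\<in>f ` K \<union> g ` K. r j = val w j}" for w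
  have val: "val w (f k) = w k" "val w (g k) = w k" if "k \<in> K" for w k
    using that inj disj by (auto simp: val_def)
  have cyl_sets: "cyl w \<in> sets coins" for w
  proof -
    have "{r \<in> space coins. \<forall>j\<in>f ` K \<union> g ` K. r j = val w j} \<in> sets coins"
      by (rule sets.sets_Collect_finite_All) (use fin coin_eq_sets in auto)
    then show ?thesis by (simp add: cyl_def)
  qed
  have sub: "{r. \<forall>k\<in>K. r (f k) = r (g k)} \<subseteq> (\<Union>w\<in>PiE K (\<lambda>_. UNIV). cyl w)"
  proof
    fix r :: "nat \<Rightarrow> bool" assume r: "r \<in> {r. \<forall>k\<in>K. r (f k) = r (g k)}"
    have "r \<in> cyl (restrict (r \<circ> f) K)"
      unfolding cyl_def
    proof (intro CollectI ballI)
      fix j assume "j \<in> f ` K \<union> g ` K"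
      then obtain k where k: "k \<in> K" "j = f k \<or> j = g k" by blast
      moreover have "r (g k) = r (f k)" using r k(1) by simp
      ultimately show "r j = val (restrict (r \<circ> f) K) j" 
        using val[OF k(1), of "restrict (r \<circ> f) K"] k by (elim disjE) simp_all
    qed
    then show "r \<in> (\<Union>w\<in>PiE K (\<lambda>_. UNIV). cyl w)"
      by (intro UN_I[of "restrict (r \<circ> f) K"]) simp_all
  qed
  have fin': "finite (PiE K (\<lambda>_. UNIV :: bool set))"
    using fin by (intro finite_PiE) auto
  have "measure coins {r. \<forall>k\<in>K. r (f k) = r (g k)} \<le>
        measure coins (\<Union>w\<in>PiE K (\<lambda>_. UNIV). cyl w)"
    by (rule coins.finite_measure_mono[OF sub]) (use cyl_sets fin' in auto)
  also have "\<dots> \<le> (\<Sum>w\<in>PiE K (\<lambda>_. UNIV). measure coins (cyl w))"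
    by (rule measure_UNION_le) (use cyl_sets fin' in auto)
  also have "\<dots> = (\<Sum>w\<in>PiE K (\<lambda>_. UNIV :: bool set). (1/2) ^ (2 * card K))"
  proof (rule sum.cong[OF refl])
    fix w
    have "card (f ` K \<union> g ` K) = 2 * card K"
      using fin inj disj by (simp add: card_Un_disjoint card_image)
    then show "measure coins (cyl w) = (1/2) ^ (2 * card K)"
      using coins_cylinder[of "f ` K \<union> g ` K" "val w"] fin by (simp add: cyl_def)
  qed
  also have "\<dots> = (1/2) ^ card K"
    using fin by (simp add: card_PiE power_mult power2_eq_square power_mult_distrib[symmetric])
  finally show ?thesis .
qed

text \<open>The shared coins serve as a random function: every pair of a tag \<open>t\<close> and a
  value \<open>v\<close> owns eight coins, so hashes of different values or under different tags are
  independent.\<close>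

definition hash_coords :: "nat \<Rightarrow> 'v::countable \<Rightarrow> nat list" where
  "hash_coords t v = map (\<lambda>i. to_nat (t, v, i)) [0..<8]"

lemma length_hash_coords [simp]: "length (hash_coords t v) = 8"
  by (simp add: hash_coords_def)

definition collide :: "(nat \<Rightarrow> bool) \<Rightarrow> nat \<Rightarrow> 'v::countable \<Rightarrow> 'v \<Rightarrow> bool" where
  "collide r t x y = (map r (hash_coords t x) = map r (hash_coords t y))"

lemma collide_refl [simp]: "collide r t x x"
  by (simp add: collide_def)

lemma collide_measurable [measurable]: "Measurable.pred coins (\<lambda>r. collide r t x y)"
  unfolding collide_def by measurable

text \<open>The tag is part of the coin index, so collisions under different tags concern disjoint
  coins and their probabilities \<open>(1/2) ^ 8\<close> multiply.\<close>

lemma measure_collide: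
  fixes x y :: "nat \<Rightarrow> 'v::countable"
  assumes fin: "finite S" and ne: "\<And>t. t \<in> S \<Longrightarrow> x t \<noteq> y t"
  shows "measure coins {r. \<forall>t\<in>S. collide r t (x t) (y t)} \<le> (1/2) ^ (8 * card S)"
proof -
  define K where "K = S \<times> {0..<8::nat}"
  have "{r. \<forall>t\<in>S. collide r t (x t) (y t)} =
        {r. \<forall>(t, i)\<in>K. r (to_nat (t, x t, i)) = r (to_nat (t, y t, i))}"
    by (auto simp: collide_def hash_coords_def K_def)
  also have "measure coins \<dots> =
    measure coins {r. \<forall>k\<in>K. r (to_nat (fst k, x (fst k), snd k)) = r (to_nat (fst k, y (fst k), snd k))}"
    by (simp add: case_prod_beta)
  also have "\<dots> \<le> (1/2) ^ card K"
    by (rule coins_agree_on_pairs) (use fin ne in \<open>auto simp: K_def inj_on_def\<close>)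
  finally show ?thesis by (simp add: K_def card_cartesian_product mult.commute)
qed

section \<open>Phrases and common prefixes\<close>

abbreviation copyable :: "'a list \<Rightarrow> nat \<Rightarrow> nat \<Rightarrow> bool" where
  "copyable S u L \<equiv> L < length S - u \<and> (L = 0 \<or> (\<exists>s<u. \<forall>i<L. S ! (s + i) = S ! (u + i)))"

lemma copyable_lz_copy_len:
  assumes "u < length S" shows "copyable S u (lz_copy_len S u)"
  unfolding lz_copy_len_def by (rule GreatestI_nat[of _ 0 "length S"]) (use assms in auto)

lemma lz_copy_len_ge: "copyable S u L \<Longrightarrow> L \<le> lz_copy_len S u"
  unfolding lz_copy_len_def by (rule Greatest_le_nat[of _ _ "length S"]) auto

text \<open>A copy that ends before \<open>l\<close> reads only positions below \<open>l\<close>, so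
  the cut merely forces the next symbol to lie inside, which leaves room for
  \<open>l - u - 1\<close> copied symbols.\<close>

lemma lz_copy_len_take:
  assumes u: "u < l" and l: "l \<le> length S"
  shows "lz_copy_len (take l S) u = min (lz_copy_len S u) (l - u - 1)"
proof (rule antisym)
  let ?L = "lz_copy_len (take l S) u"
  have cp: "copyable (take l S) u ?L"
    by (rule copyable_lz_copy_len) (use assms in auto)
  then have "?L < l - u" using l by auto
  moreover from cp this have "copyable S u ?L" using l by auto
  then have "?L \<le> lz_copy_len S u" by (rule lz_copy_len_ge)
  ultimately show "?L \<le> min (lz_copy_len S u) (l - u - 1)" by simp
next
  have "copyable S u (lz_copy_len S u)"
    by (rule copyable_lz_copy_len) (use assms in auto)
  then have "copyable (take l S) u (min (lz_copy_len S u) (l - u - 1))"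
    using assms by auto
  then show "min (lz_copy_len S u) (l - u - 1) \<le> lz_copy_len (take l S) u"
    by (rule lz_copy_len_ge)
qed

text \<open>The sequence continues beyond the end of \<open>S\<close>, where
  \<open>lz_copy_len\<close> is unspecified; the summand 1 keeps it strictly increasing there
  too.\<close>

primrec phrase_start :: "'a list \<Rightarrow> nat \<Rightarrow> nat" where
  "phrase_start S 0 = 0"
| "phrase_start S (Suc j) = phrase_start S j + lz_copy_len S (phrase_start S j) + 1"

lemma strict_mono_phrase_start: "strict_mono (phrase_start S)"
  by (rule strict_mono_Suc_iff[THEN iffD2]) simp

lemma phrase_start_ge: "j \<le> phrase_start S j"
  using strict_mono_phrase_start by (rule strict_mono_imp_increasing)

lemma lz_phrases_from_phrase_start:
  "j \<le> i \<Longrightarrow> phrase_start S i < length S \<longleftrightarrow> i < j + lz_phrases_from S (phrase_start S j)"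
proof (induction "length S - phrase_start S j" arbitrary: j rule: less_induct)
  case less
  show ?case
  proof (cases "phrase_start S j < length S")
    case False
    then have "length S \<le> phrase_start S i"
      using strict_mono_less_eq[OF strict_mono_phrase_start, of S j i] less.prems by linarith
    then show ?thesis using False less.prems by simp
  next
    case True
    have num: "lz_phrases_from S (phrase_start S j) = Suc (lz_phrases_from S (phrase_start S (Suc j)))"
      using True by (subst lz_phrases_from.simps) simp
    show ?thesis
    proof (cases "i = j")
      case True
      then show ?thesis using num \<open>phrase_start S j < length S\<close> by simp
    next
      case False
      have "phrase_start S i < length S \<longleftrightarrow> i < Suc j + lz_phrases_from S (phrase_start S (Suc j))"
        by (rule less.hyps) (use True False less.prems in auto)
      then show ?thesis using num by simp
    qed
  qed
qed

lemma phrase_start_less_iff: "phrase_start S i < length S \<longleftrightarrow> i < lz77_num_phrases S"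
  using lz_phrases_from_phrase_start[of 0 i S] by (simp add: lz77_num_phrases_def)

text \<open>A phrase shortened by the cut ends exactly at \<open>l\<close>. As long as one of the
  two starts is below \<open>l\<close>, no earlier phrase was shortened.\<close>

lemma phrase_start_take:
  assumes "l \<le> length S"
  shows "phrase_start (take l S) j < l \<or> phrase_start S j < l \<Longrightarrow>
         phrase_start (take l S) j = phrase_start S j"
proof (induction j)
  case (Suc j)
  then have eq: "phrase_start (take l S) j = phrase_start S j" by auto
  then have lt: "phrase_start S j < l" using Suc.prems by auto
  show ?case
    using Suc.prems lz_copy_len_take[OF lt assms] by (auto simp: eq min_def split: if_splits)
qed simp

lemma phrase_start_prefix:
  assumes "l \<le> length S"
  shows "phrase_start S j < l \<longleftrightarrow> j < lz77_num_phrases (take l S)"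
  using phrase_start_take[OF assms, of j] phrase_start_less_iff[of "take l S" j] assms
  by auto

lemma lz77_num_phrases_le: "lz77_num_phrases S \<le> length S"
proof (cases "lz77_num_phrases S")
  case (Suc z)
  then show ?thesis
    using phrase_start_less_iff[of S z] phrase_start_ge[of z S] by simp
qed simp

lemma lcp_le: "lcp X Y \<le> length X" "lcp X Y \<le> length Y"
  and take_lcp: "take (lcp X Y) X = take (lcp X Y) Y"
proof -
  have "lcp X Y \<le> length X \<and> lcp X Y \<le> length Y \<and> take (lcp X Y) X = take (lcp X Y) Y"
    unfolding lcp_def by (rule GreatestI_nat[of _ 0 "length X"]) auto
  then show "lcp X Y \<le> length X" "lcp X Y \<le> length Y" "take (lcp X Y) X = take (lcp X Y) Y"
    by auto
qed

lemma le_lcp: "l \<le> length X \<Longrightarrow> l \<le> length Y \<Longrightarrow> take l X = take l Y \<Longrightarrow> l \<le> lcp X Y"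
  unfolding lcp_def by (rule Greatest_le_nat[of _ _ "length X"]) auto

lemma nth_lcp: "i < lcp X Y \<Longrightarrow> X ! i = Y ! i"
  using take_lcp[of X Y] by (metis nth_take)

lemma le_lcpI:
  assumes "l \<le> length X" "l \<le> length Y" "\<And>i. i < l \<Longrightarrow> X ! i = Y ! i"
  shows "l \<le> lcp X Y"
  using assms by (intro le_lcp nth_equalityI) auto

lemma lcp_mismatch:
  assumes "lcp X Y < length X" "lcp X Y < length Y"
  shows "X ! lcp X Y \<noteq> Y ! lcp X Y"
proof
  assume "X ! lcp X Y = Y ! lcp X Y"
  then have "Suc (lcp X Y) \<le> lcp X Y"
    using assms by (intro le_lcpI) (auto simp: less_Suc_eq nth_lcp)
  then show False by simp
qed

text \<open>The token \<open>Inr w\<close> marks a missing phrase and names the party, so Alice and Bob disagree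
  beyond the end of their parses; index 0 is a sentinel on which they always agree.\<close>
definition checkpoint :: "bool \<Rightarrow> 'a list \<Rightarrow> nat \<Rightarrow> 'a list + bool" where
  "checkpoint w S j = (case j of 0 \<Rightarrow> Inl []
     | Suc i \<Rightarrow> if phrase_start S i < length S then Inl (take (phrase_start S i) S) else Inr w)"

definition checkpoint_pos :: "'a list \<Rightarrow> nat \<Rightarrow> nat" where
  "checkpoint_pos S j = (case j of 0 \<Rightarrow> 0 | Suc i \<Rightarrow> phrase_start S i)"

lemma checkpoint_eqD:
  assumes "checkpoint True A q = checkpoint False B q"
  shows "checkpoint_pos A q = checkpoint_pos B q" "checkpoint_pos A q \<le> lcp A B"
proof -
  have "checkpoint_pos A q = checkpoint_pos B q \<and> checkpoint_pos A q \<le> lcp A B"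
  proof (cases q)
    case 0
    then show ?thesis by (simp add: checkpoint_pos_def)
  next
    case (Suc i)
    then have *: "phrase_start A i < length A" "phrase_start B i < length B"
      "take (phrase_start A i) A = take (phrase_start B i) B"
      using assms by (auto simp: checkpoint_def split: if_splits)
    then have eq: "phrase_start A i = phrase_start B i"
      by (metis length_take min.absorb2 min.commute less_imp_le)
    then show ?thesis using * Suc by (auto simp: checkpoint_pos_def intro!: le_lcp)
  qed
  then show "checkpoint_pos A q = checkpoint_pos B q" "checkpoint_pos A q \<le> lcp A B" by auto
qed

text \<open>Starts \<open>0\<close> to \<open>z - 1\<close> lie inside the common prefix and
  coincide. Start \<open>z\<close> lies at \<open>lcp A B\<close> or beyond; it can still agree if
  it equals \<open>lcp A B\<close>, which gives \<open>q = Suc z\<close>. Later starts lie strictly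
  beyond and disagree. The sentinel shifts all indices by one.\<close>

lemma checkpoint_last_equal:
  fixes A B :: "'a list"
  defines "z \<equiv> lz77_num_phrases (take (lcp A B) A)"
  obtains q where "q \<le> Suc z" "\<And>j. checkpoint True A j = checkpoint False B j \<longleftrightarrow> j \<le> q"
    "z \<le> q"
proof -
  define l where "l = lcp A B"
  have A: "phrase_start A j < l \<longleftrightarrow> j < z" for j
    using phrase_start_prefix[of "lcp A B" A j, OF lcp_le(1)] by (simp add: z_def l_def)
  have B: "phrase_start B j < l \<longleftrightarrow> j < z" for j
    using phrase_start_prefix[of "lcp A B" B j, OF lcp_le(2)] by (simp add: z_def l_def take_lcp[of A B])
  have same: "phrase_start A j = phrase_start B j" if "j < z" for j
    using phrase_start_take[of "lcp A B" A j, OF lcp_le(1)] phrase_start_take[of "lcp A B" B j, OF lcp_le(2)]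
      that A B by (simp add: l_def take_lcp[of A B])
  have eq: "checkpoint True A j = checkpoint False B j" if "j \<le> z" for j
  proof (cases j)
    case 0
    then show ?thesis by (simp add: checkpoint_def)
  next
    case (Suc i)
    have i: "i < z" using that Suc by simp
    then have i_l: "phrase_start B i < l" by (simp add: B)
    have "phrase_start B i < length A" "phrase_start B i < length B"
      using i_l lcp_le[of A B] by (auto simp: l_def)
    moreover have "take (phrase_start B i) A = take (phrase_start B i) B"
      using i_l take_lcp[of A B] unfolding l_def by (metis less_imp_le min.absorb1 take_take)
    ultimately show ?thesis using Suc same[OF i] by (simp add: checkpoint_def)
  qed
  have ne: "checkpoint True A j \<noteq> checkpoint False B j" if "Suc z < j" for j
  proof
    assume *: "checkpoint True A j = checkpoint False B j"
    obtain i where i: "j = Suc i" "z < i" using \<open>Suc z < j\<close> by (cases j) auto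
    have "checkpoint_pos A j \<le> l" using checkpoint_eqD[OF *] by (simp add: l_def)
    then have "phrase_start A i \<le> l" using i by (simp add: checkpoint_pos_def)
    moreover have "phrase_start A z < phrase_start A i"
      using i strict_mono_less[OF strict_mono_phrase_start] by blast
    ultimately have "phrase_start A z < l" by simp
    then show False using A by simp
  qed
  show thesis
  proof (cases "checkpoint True A (Suc z) = checkpoint False B (Suc z)")
    case True
    show ?thesis
    proof (rule that[of "Suc z"])
      fix j show "checkpoint True A j = checkpoint False B j \<longleftrightarrow> j \<le> Suc z"
        using eq[of j] ne[of j] True by (metis le_Suc_eq not_less)
    qed auto
  next
    case False
    show ?thesis
    proof (rule that[of z])
      fix j show "checkpoint True A j = checkpoint False B j \<longleftrightarrow> j \<le> z"
        using eq[of j] ne[of j] False by (metis not_less_eq less_antisym not_less)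
    qed auto
  qed
qed

section \<open>Extending a string from a given source\<close>

definition source :: "'a list \<Rightarrow> nat \<Rightarrow> nat" where
  "source S u = (if u = 0 then 0
     else SOME s. s < u \<and> (\<forall>i<lz_copy_len S u. S ! (s + i) = S ! (u + i)))"

text \<open>Unlike the copied part of a phrase, the match needs no symbol after it, and its source
  is prescribed, so Bob can evaluate it for Alice's source. The alternative \<open>M = 0\<close>
  supplies a value if \<open>s < u\<close> or \<open>u \<le> length S\<close> fails.\<close>

definition self_match :: "'a list \<Rightarrow> nat \<Rightarrow> nat \<Rightarrow> nat" where
  "self_match S u s = (GREATEST M. M = 0 \<or>
     s < u \<and> u + M \<le> length S \<and> (\<forall>i<M. S ! (s + i) = S ! (u + i)))"

lemma self_match_cases:
  "self_match S u s = 0 \<or>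
     s < u \<and> u + self_match S u s \<le> length S \<and> (\<forall>i<self_match S u s. S ! (s + i) = S ! (u + i))"
  unfolding self_match_def
  by (rule GreatestI_nat[where P = "\<lambda>M. M = 0 \<or>
        s < u \<and> u + M \<le> length S \<and> (\<forall>i<M. S ! (s + i) = S ! (u + i))" and k = 0 and b = "length S"]) auto

lemma self_match_ge:
  "s < u \<Longrightarrow> u + M \<le> length S \<Longrightarrow> \<forall>i<M. S ! (s + i) = S ! (u + i) \<Longrightarrow> M \<le> self_match S u s"
  unfolding self_match_def by (rule Greatest_le_nat[of _ _ "length S"]) auto

lemma source_properties:
  assumes "0 < u" "u < length S"
  shows "source S u < u" "\<forall>i<lz_copy_len S u. S ! (source S u + i) = S ! (u + i)"
proof -
  have "\<exists>s<u. \<forall>i<lz_copy_len S u. S ! (s + i) = S ! (u + i)"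
    using copyable_lz_copy_len[OF assms(2)] assms(1) by auto
  then have "source S u < u \<and> (\<forall>i<lz_copy_len S u. S ! (source S u + i) = S ! (u + i))"
    using assms(1) unfolding source_def by (simp only: neq0_conv[THEN iffD2] if_False) (rule someI_ex)
  then show "source S u < u" "\<forall>i<lz_copy_len S u. S ! (source S u + i) = S ! (u + i)" by auto
qed

lemma lz_copy_len_le_self_match:
  assumes "u < length S" shows "lz_copy_len S u \<le> self_match S u (source S u)"
proof (cases "u = 0")
  case True
  then show ?thesis using copyable_lz_copy_len[OF assms] by simp
next
  case False
  then show ?thesis
    using source_properties[of u S] copyable_lz_copy_len[OF assms] assms
    by (intro self_match_ge) auto
qed

lemma source_le: "u < length S \<or> u = 0 \<Longrightarrow> source S u \<le> u"
  using source_properties(1)[of u S] by (cases "u = 0") (auto simp: source_def)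

text \<open>Alice's phrase at \<open>u\<close> ends at start number \<open>q\<close>, which is not
  inside the common prefix because \<open>q\<close> is at least its number of phrases. The 1 is the
  final symbol of the phrase.\<close>

lemma lcp_le_self_match:
  assumes q: "\<And>j. checkpoint True A j = checkpoint False B j \<longleftrightarrow> j \<le> q"
    and z: "lz77_num_phrases (take (lcp A B) A) \<le> q"
  defines "u \<equiv> checkpoint_pos A q"
  shows "lcp A B \<le> u + self_match A u (source A u) + 1" "source A u \<le> u"
proof -
  have "lcp A B \<le> u + self_match A u (source A u) + 1 \<and> source A u \<le> u"
  proof (cases q)
    case 0
    then have "lcp A B = 0"
      using z phrase_start_prefix[of "lcp A B" A 0, OF lcp_le(1)] by auto
    moreover have "u = 0" using 0 by (simp add: u_def checkpoint_pos_def)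
    ultimately show ?thesis by (simp add: source_def)
  next
    case (Suc i)
    have u: "u = phrase_start A i" using Suc by (simp add: u_def checkpoint_pos_def)
    have "u < length A"
      using q[of q] Suc u by (auto simp: checkpoint_def split: if_splits)
    moreover have "\<not> phrase_start A q < lcp A B"
      using z phrase_start_prefix[of "lcp A B" A q, OF lcp_le(1)] by auto
    ultimately show ?thesis
      using Suc u lz_copy_len_le_self_match[of u A] source_le[of u A] by simp
  qed
  then show "lcp A B \<le> u + self_match A u (source A u) + 1" "source A u \<le> u" by auto
qed

definition symbol_at :: "'a list \<Rightarrow> nat \<Rightarrow> 'a option" where
  "symbol_at S i = (if i < length S then Some (S ! i) else None)"

text \<open>After matches of equal length one more symbol may agree; \<open>None\<close> stands for
  the end of a string and never counts as agreement.\<close>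

definition match_end :: "nat \<Rightarrow> nat \<Rightarrow> 'a option \<Rightarrow> nat \<Rightarrow> 'a option \<Rightarrow> nat" where
  "match_end u M a N b = u + min M N + (if M = N \<and> a = b \<and> a \<noteq> None then 1 else 0)"

lemma match_end_commute: "match_end u M a N b = match_end u N b M a"
  by (auto simp: match_end_def)

text \<open>A common prefix of length \<open>u\<close> determines the self-extension from the source \<open>s\<close>, so both
  strings follow it until the first of them leaves it.\<close>
lemma lcp_ge_self_match:
  assumes "u \<le> lcp A B"
  shows "u + min (self_match A u s) (self_match B u s) \<le> lcp A B"
proof -
  let ?m = "min (self_match A u s) (self_match B u s)"
  show ?thesis
  proof (cases "?m = 0")
    case False
    then have A: "s < u" "u + self_match A u s \<le> length A"
      "\<And>i. i < self_match A u s \<Longrightarrow> A ! (s + i) = A ! (u + i)"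
      and B: "u + self_match B u s \<le> length B"
      "\<And>i. i < self_match B u s \<Longrightarrow> B ! (s + i) = B ! (u + i)"
      using self_match_cases[of A u s] self_match_cases[of B u s] by auto
    have "A ! i = B ! i" if "i < u + ?m" for i
      using that
    proof (induction i rule: less_induct)
      case (less i)
      show ?case
      proof (cases "i < u")
        case True
        then show ?thesis using assms by (intro nth_lcp) simp
      next
        case False
        define j where "j = i - u"
        have j: "i = u + j" "j < ?m" using False less.prems by (auto simp: j_def)
        have "A ! (s + j) = B ! (s + j)" using less A(1) j by simp
        then show ?thesis using A(3)[of j] B(2)[of j] j by simp
      qed
    qed
    then show ?thesis using A B by (intro le_lcpI) auto
  qed (use assms in simp)
qed

text \<open>If the common prefix reached further, \<open>A\<close> would inherit from
  \<open>B\<close> the next equality between source and copy, and its match would be longer.\<close>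

lemma lcp_le_longer_self_match:
  assumes lt: "self_match A u s < self_match B u s" and u: "u \<le> lcp A B"
  shows "lcp A B = u + self_match A u s"
proof (rule ccontr)
  let ?M = "self_match A u s"
  assume "lcp A B \<noteq> u + ?M"
  then have l: "u + ?M < lcp A B" using lcp_ge_self_match[OF u, of s] lt by simp
  have B: "s < u" "u + self_match B u s \<le> length B"
    "\<And>i. i < self_match B u s \<Longrightarrow> B ! (s + i) = B ! (u + i)"
    using self_match_cases[of B u s] lt by auto
  have "A ! (s + i) = A ! (u + i)" if "i < Suc ?M" for i
  proof -
    have "A ! (s + i) = B ! (s + i)" "A ! (u + i) = B ! (u + i)"
      using that l B(1) by (auto intro!: nth_lcp)
    then show ?thesis using B(3)[of i] that lt by simp
  qed
  then have "Suc ?M \<le> ?M"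
    using B(1) l lcp_le(1)[of A B] by (intro self_match_ge) auto
  then show False by simp
qed

lemma lcp_commute: "lcp A B = lcp B A"
  unfolding lcp_def by (rule arg_cong[where f = Greatest]) auto

text \<open>Unequal matches are settled by the shorter one; for equal matches the bound on
  \<open>lcp A B\<close> leaves only the symbol behind the match undecided.\<close>

lemma lcp_eq_match_end:
  assumes u: "u \<le> lcp A B" and l: "lcp A B \<le> u + self_match A u s + 1"
  defines "M \<equiv> self_match A u s" and "N \<equiv> self_match B u s"
  shows "lcp A B = match_end u M (symbol_at A (u + M)) N (symbol_at B (u + N))"
proof (cases M N rule: linorder_cases)
  case less
  then show ?thesis
    using lcp_le_longer_self_match[of A u s B] u by (simp add: M_def N_def match_end_def)
next
  case greater
  then show ?thesis
    using lcp_le_longer_self_match[of B u s A] u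
    by (simp add: M_def N_def match_end_def lcp_commute)
next
  case equal
  have ge: "u + M \<le> lcp A B" using lcp_ge_self_match[OF u, of s] equal by (simp add: M_def N_def)
  show ?thesis
  proof (cases "lcp A B = u + M")
    case True
    then have "\<not> (symbol_at A (u + M) = symbol_at B (u + M) \<and> symbol_at A (u + M) \<noteq> None)"
      using lcp_mismatch[of A B] by (auto simp: symbol_at_def)
    then show ?thesis using True equal by (auto simp: match_end_def)
  next
    case False
    then have "lcp A B = u + M + 1" using l ge by (simp add: M_def)
    moreover from this have "u + M < length A" "u + M < length B" "A ! (u + M) = B ! (u + M)"
      using lcp_le[of A B] by (auto intro!: nth_lcp)
    ultimately show ?thesis using equal by (simp add: match_end_def symbol_at_def)
  qed
qed

section \<open>Noisy binary search\<close>

definition low :: "nat list \<Rightarrow> nat" where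
  "low st = (case st of [] \<Rightarrow> 0 | x # _ \<Rightarrow> x)"

lemma low_simps [simp]: "low [] = 0" "low (x # xs) = x"
  by (simp_all add: low_def)

text \<open>A stack of length \<open>k \<le> n\<close> stands for the interval of length
  \<open>2 ^ (n - k)\<close> from its top entry; the entries below allow backtracking. From depth
  \<open>n\<close> on both tests look at the same index.\<close>

definition mid :: "nat \<Rightarrow> nat list \<Rightarrow> nat" where
  "mid n st = low st + (if length st < n then 2 ^ (n - Suc (length st)) else 0)"

definition verdict :: "bool \<Rightarrow> bool \<Rightarrow> nat" where
  "verdict e f = (if \<not> e then 0 else if f then 1 else 2)"

text \<open>Taking the lower half pushes the old lower end again, so that the depth counts the
  halvings.\<close>

definition refine :: "nat \<Rightarrow> nat list \<Rightarrow> nat \<Rightarrow> nat list" where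
  "refine n st y = (if y = 0 then tl st else (if y = 1 then mid n st else low st) # st)"

text \<open>\<open>w\<close> fixes the false agreements in advance. Errors are one-sided: a test at
  an index up to \<open>q\<close> always succeeds.\<close>

primrec walk :: "nat \<Rightarrow> nat \<Rightarrow> (nat \<Rightarrow> bool \<times> bool) \<Rightarrow> nat \<Rightarrow> nat list" where
  "walk n q w 0 = []"
| "walk n q w (Suc t) = (let st = walk n q w t in
     refine n st (verdict (low st \<le> q \<or> fst (w t)) (mid n st \<le> q \<or> snd (w t))))"

text \<open>With a wrong lower end the right reply is to backtrack, which the first flag alone
  decides; with a right one, only the midpoint test can err.\<close>

definition misled :: "nat \<Rightarrow> nat \<Rightarrow> nat list \<Rightarrow> bool \<times> bool \<Rightarrow> bool" where
  "misled n q st f = (if q < low st then fst f else q < mid n st \<and> snd f)"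

definition misled_steps :: "nat \<Rightarrow> nat \<Rightarrow> (nat \<Rightarrow> bool \<times> bool) \<Rightarrow> nat \<Rightarrow> nat set" where
  "misled_steps n q w t = {i. i < t \<and> misled n q (walk n q w i) (w i)}"

text \<open>A stack consists of a part \<open>gs\<close> that describes intervals around \<open>q\<close>, topped by wrong
  entries \<open>bs\<close>; the distance \<open>d\<close> to a stack that pins down \<open>q\<close> changes by one in each step.
  No wrong entry is ever pushed on a stack of at least \<open>n\<close> right entries, because then all tests
  compare equal values.\<close>
definition at_distance :: "nat \<Rightarrow> nat \<Rightarrow> nat list \<Rightarrow> int \<Rightarrow> bool" where
  "at_distance n q st d = (\<exists>bs gs. st = bs @ gs \<and> low gs \<le> q \<and> q < low gs + 2 ^ (n - length gs) \<and>
     (\<forall>x\<in>set bs. q < x) \<and> (bs \<noteq> [] \<longrightarrow> length gs < n) \<and>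
     d = int n + int (length bs) - int (length gs))"

text \<open>A misled step pushes a wrong entry; above a wrong entry it exceeds \<open>q\<close>
  because \<open>mid\<close> is at least \<open>low\<close>. Any other step removes a wrong entry
  or, if there is none, pushes a right one.\<close>

lemma at_distance_refine:
  assumes "at_distance n q st d"
  shows "at_distance n q (refine n st (verdict (low st \<le> q \<or> f1) (mid n st \<le> q \<or> f2)))
           (if misled n q st (f1, f2) then d + 1 else d - 1)"
proof -
  obtain bs gs where st: "st = bs @ gs" and gs: "low gs \<le> q" "q < low gs + 2 ^ (n - length gs)"
    and bs: "\<forall>x\<in>set bs. q < x" "bs \<noteq> [] \<longrightarrow> length gs < n"
    and d: "d = int n + int (length bs) - int (length gs)"
    using assms unfolding at_distance_def by blast
  define st' where "st' = refine n st (verdict (low st \<le> q \<or> f1) (mid n st \<le> q \<or> f2))"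
  define d' where "d' = (if misled n q st (f1, f2) then d + 1 else d - 1)"
  have intro: "at_distance n q st' d'"
    if "st' = bs' @ gs'" "low gs' \<le> q" "q < low gs' + 2 ^ (n - length gs')"
      "\<forall>x\<in>set bs'. q < x" "bs' \<noteq> [] \<longrightarrow> length gs' < n"
      "d' = int n + int (length bs') - int (length gs')" for bs' gs'
    using that unfolding at_distance_def by blast
  show ?thesis
  proof (cases bs)
    case Nil
    show ?thesis
    proof (cases "length gs < n")
      case False
      then show ?thesis
        using gs Nil st d unfolding st'_def[symmetric] d'_def[symmetric]
        by (intro intro[of "[]" "low gs # gs"])
           (auto simp: st'_def d'_def refine_def verdict_def mid_def misled_def)
    next
      case True
      define h :: nat where "h = 2 ^ (n - Suc (length gs))"
      have h: "2 ^ (n - length gs) = 2 * h"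
        using True by (simp add: h_def Suc_diff_Suc flip: power_Suc)
      have mid: "mid n st = low gs + h"
        using True Nil st by (simp add: mid_def h_def)
      consider "low gs + h \<le> q" | "q < low gs + h" f2 | "q < low gs + h" "\<not> f2" by linarith
      then show ?thesis unfolding st'_def[symmetric] d'_def[symmetric]
      proof cases
        case 1
        then show "at_distance n q st' d'"
          using gs Nil st d mid h
          by (intro intro[of "[]" "(low gs + h) # gs"])
             (auto simp: st'_def d'_def refine_def verdict_def misled_def h_def[symmetric])
      next
        case 2
        then show "at_distance n q st' d'"
          using gs Nil st d mid h True
          by (intro intro[of "[low gs + h]" gs])
             (auto simp: st'_def d'_def refine_def verdict_def misled_def)
      next
        case 3
        then show "at_distance n q st' d'"
          using gs Nil st d mid h
          by (intro intro[of "[]" "low gs # gs"])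
             (auto simp: st'_def d'_def refine_def verdict_def misled_def h_def[symmetric])
      qed
    qed
  next
    case (Cons x bs')
    then have x: "low st = x" "q < x" "x \<le> mid n st" using st bs by (auto simp: mid_def)
    show ?thesis unfolding st'_def[symmetric] d'_def[symmetric]
    proof (cases f1)
      case True
      then show "at_distance n q st' d'"
        using gs bs st d x Cons
        by (intro intro[of "(if f2 then mid n st else x) # bs" gs])
           (auto simp: st'_def d'_def refine_def verdict_def misled_def)
    next
      case False
      then show "at_distance n q st' d'"
        using gs bs st d x Cons
        by (intro intro[of bs' gs])
           (auto simp: st'_def d'_def refine_def verdict_def misled_def)
    qed
  qed
qed

lemma at_distance_walk:
  assumes "q < 2 ^ n"
  shows "at_distance n q (walk n q w t) (int n - int t + 2 * int (card (misled_steps n q w t)))"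
proof (induction t)
  case 0
  then show ?case using assms by (auto simp: at_distance_def misled_steps_def)
next
  case (Suc t)
  have "misled_steps n q w (Suc t) = (if misled n q (walk n q w t) (w t)
      then insert t (misled_steps n q w t) else misled_steps n q w t)"
    by (auto simp: misled_steps_def less_Suc_eq)
  moreover have "finite (misled_steps n q w t)" "t \<notin> misled_steps n q w t"
    by (auto simp: misled_steps_def)
  ultimately show ?case
    using at_distance_refine[OF Suc, of "fst (w t)" "snd (w t)"]
    by (auto simp: Let_def algebra_simps split: if_splits)
qed

text \<open>By \<open>n - 3 * n + 2 * n = 0\<close> the final distance is at most 0, which excludes
  wrong entries and leaves an interval of width one.\<close>

lemma low_walk:
  assumes q: "q < 2 ^ n" and m: "card (misled_steps n q w (3 * n)) \<le> n"
  shows "low (walk n q w (3 * n)) = q"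
proof -
  obtain d where d: "at_distance n q (walk n q w (3 * n)) d" "d \<le> 0"
    using at_distance_walk[OF q, of w "3 * n"] m by fastforce
  then show ?thesis unfolding at_distance_def by (auto split: if_splits)
qed

lemma walk_cong: "(\<And>i. i < t \<Longrightarrow> w i = w' i) \<Longrightarrow> walk n q w t = walk n q w' t"
  by (induction t) auto

section \<open>The search driven by hash tests\<close>

definition flags :: "(nat \<Rightarrow> bool) \<Rightarrow> nat \<Rightarrow> (nat \<Rightarrow> 'v::countable) \<Rightarrow> (nat \<Rightarrow> 'v) \<Rightarrow> nat \<Rightarrow> nat list \<Rightarrow> bool \<times> bool" where
  "flags r n x y t st = (collide r (Suc t) (x (low st)) (y (low st)),
                         collide r (Suc t) (x (mid n st)) (y (mid n st)))"

primrec hash_walk :: "(nat \<Rightarrow> bool) \<Rightarrow> nat \<Rightarrow> (nat \<Rightarrow> 'v::countable) \<Rightarrow> (nat \<Rightarrow> 'v) \<Rightarrow> nat \<Rightarrow> nat list" where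
  "hash_walk r n x y 0 = []"
| "hash_walk r n x y (Suc t) = (let st = hash_walk r n x y t; f = flags r n x y t st in
     refine n st (verdict (fst f) (snd f)))"

text \<open>Equal values have equal hashes, so the answers have the form that \<open>walk\<close>
  expects, with the observed collisions as error flags.\<close>

lemma hash_walk_eq_walk:
  assumes "\<And>j. x j = y j \<longleftrightarrow> j \<le> q"
  shows "hash_walk r n x y t = walk n q (\<lambda>t. flags r n x y t (hash_walk r n x y t)) t"
proof (induction t)
  case (Suc t)
  have "j \<le> q \<or> collide r (Suc t) (x j) (y j) \<longleftrightarrow> collide r (Suc t) (x j) (y j)" for j
    using assms[of j] by (metis collide_refl)
  then show ?case using Suc by (simp add: Let_def flags_def)
qed simp

text \<open>A union bound over error patterns. A pattern determines the whole walk and thus the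
  indices compared, which removes the adaptivity. There are at most
  \<open>4 ^ (3 * n) = 64 ^ n\<close> patterns, and the collisions required by one with more than
  \<open>n\<close> misled steps have probability at most \<open>(1/256) ^ Suc n\<close>.\<close>

lemma hash_walk_failure:
  fixes x y :: "nat \<Rightarrow> 'v::countable"
  assumes xy: "\<And>j. x j = y j \<longleftrightarrow> j \<le> q" and q: "q < 2 ^ n"
  shows "\<exists>E\<in>sets coins. measure coins E \<le> 1/4 \<and> (\<forall>r. r \<notin> E \<longrightarrow> low (hash_walk r n x y (3 * n)) = q)"
proof -
  define T where "T = 3 * n"
  define pats where "pats = {p \<in> PiE {..<T} (\<lambda>_. UNIV :: (bool \<times> bool) set). n < card (misled_steps n q p T)}"
  \<comment> \<open>At a misled step this is the index whose test errs; it exceeds \<open>q\<close>,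
    so the values compared differ.\<close>
  define idx where "idx p t = (let st = walk n q p t in if q < low st then low st else mid n st)"
    for p t
  define ev where "ev p = {r. \<forall>t\<in>Suc ` misled_steps n q p T. collide r t (x (idx p (t - 1))) (y (idx p (t - 1)))}"
    for p
  define E where "E = (\<Union>p\<in>pats. ev p)"
  have fin_steps: "finite (misled_steps n q p T)" for p by (simp add: misled_steps_def)
  have ev_sets: "ev p \<in> sets coins" for p
  proof -
    have "{r \<in> space coins. \<forall>t\<in>Suc ` misled_steps n q p T. collide r t (x (idx p (t - 1))) (y (idx p (t - 1)))} \<in> sets coins"
      by (rule sets.sets_Collect_finite_All) (use fin_steps collide_measurable[unfolded pred_def] in auto)
    then show ?thesis by (simp add: ev_def)
  qed
  have fin_PiE: "finite (PiE {..<T} (\<lambda>_. UNIV :: (bool \<times> bool) set))"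
    by (intro finite_PiE) auto
  then have fin: "finite pats" by (simp add: pats_def)
  have "card pats \<le> card (PiE {..<T} (\<lambda>_. UNIV :: (bool \<times> bool) set))"
    by (rule card_mono[OF fin_PiE]) (auto simp: pats_def)
  also have "\<dots> = 4 ^ T" by (simp add: card_PiE UNIV_bool card_cartesian_product numeral_eq_Suc flip: UNIV_Times_UNIV)
  finally have card_pats: "card pats \<le> 4 ^ T" .
  have ev_measure: "measure coins (ev p) \<le> (1/2) ^ (8 * Suc n)" if "p \<in> pats" for p
  proof -
    have "measure coins (ev p) \<le> (1/2) ^ (8 * card (Suc ` misled_steps n q p T))"
      unfolding ev_def
    proof (rule measure_collide)
      fix t assume "t \<in> Suc ` misled_steps n q p T"
      then have "q < idx p (t - 1)"
        by (auto simp: misled_steps_def misled_def idx_def Let_def split: if_splits)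
      then show "x (idx p (t - 1)) \<noteq> y (idx p (t - 1))" using xy by simp
    qed (simp add: fin_steps)
    also have "\<dots> \<le> (1/2) ^ (8 * Suc n)"
      using that by (intro power_decreasing) (auto simp: pats_def card_image)
    finally show ?thesis .
  qed
  have "measure coins E \<le> (\<Sum>p\<in>pats. measure coins (ev p))"
    unfolding E_def by (rule measure_UNION_le) (use fin ev_sets in auto)
  also have "\<dots> \<le> real (card pats) * (1/2) ^ (8 * Suc n)"
    using sum_mono[OF ev_measure] by simp
  also have "\<dots> \<le> 4 ^ T * (1/2) ^ (8 * Suc n)"
  proof (rule mult_right_mono)
    show "real (card pats) \<le> 4 ^ T"
      using card_pats by (metis of_nat_le_iff of_nat_numeral of_nat_power)
  qed simp
  also have "\<dots> = (1/4) ^ n * (1/256)"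
  proof -
    have "(4::real) ^ T = 64 ^ n"
      by (simp add: T_def power_mult)
    moreover have "(1/2::real) ^ 8 = 1/256" by (simp add: power_divide)
    then have "(1/2::real) ^ (8 * Suc n) = (1/256) ^ n * (1/256)"
      by (simp only: power_mult[of "1/2::real" 8 "Suc n"] power_Suc2)
    ultimately have "4 ^ T * (1/2::real) ^ (8 * Suc n) = (64 * (1/256)) ^ n * (1/256)"
      by (simp only: power_mult_distrib mult.assoc)
    then show ?thesis by simp
  qed
  also have "\<dots> \<le> 1 * (1/256)" by (intro mult_right_mono power_le_one) auto
  also have "\<dots> \<le> 1/4" by simp
  finally have "measure coins E \<le> 1/4" .
  moreover have "E \<in> sets coins" unfolding E_def using fin ev_sets by auto
  moreover have "low (hash_walk r n x y (3 * n)) = q" if r: "r \<notin> E" for r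
  proof -
    define w where "w = (\<lambda>t. flags r n x y t (hash_walk r n x y t))"
    have hw: "hash_walk r n x y t = walk n q w t" for t
      unfolding w_def by (rule hash_walk_eq_walk[OF xy])
    \<comment> \<open>The flags that actually occur form a pattern, and \<open>r\<close> has all
      collisions it prescribes; with too many misled steps, \<open>r\<close> would lie in
      \<open>E\<close>.\<close>
    define p where "p = restrict w {..<T}"
    have wp: "walk n q p t = walk n q w t" if "t \<le> T" for t
      by (rule walk_cong) (use that in \<open>auto simp: p_def\<close>)
    have steps: "misled_steps n q p T = misled_steps n q w T"
      unfolding misled_steps_def using wp by (auto simp: p_def)
    have "r \<in> ev p"
    proof -
      have "collide r (Suc t) (x (idx p t)) (y (idx p t))" if "t \<in> misled_steps n q p T" for t
      proof -
        have t: "t < T" "misled n q (walk n q w t) (w t)"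
          using that unfolding steps by (auto simp: misled_steps_def)
        moreover have "w t = flags r n x y t (walk n q w t)"
          unfolding hw[symmetric] by (simp add: w_def)
        ultimately show ?thesis
          using wp[of t] by (auto simp: idx_def Let_def misled_def flags_def split: if_splits)
      qed
      then show ?thesis by (auto simp: ev_def)
    qed
    then have "p \<notin> pats" using r by (auto simp: E_def)
    then have "card (misled_steps n q w T) \<le> n"
      using steps by (auto simp: pats_def p_def)
    then show ?thesis using low_walk[OF q] hw by (simp add: T_def)
  qed
  ultimately show ?thesis by blast
qed

section \<open>Searching for the first differing phrase\<close>

abbreviation announce :: "bool \<Rightarrow> ('a list \<Rightarrow> nat) \<Rightarrow> (nat \<Rightarrow> 'a ptree) \<Rightarrow> 'a ptree" where
  "announce w f k \<equiv> Message w (\<lambda>_. []) (\<lambda>X _. f X) k"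

lemma exec_announce:
  assumes "length (code (f (party w A B))) \<le> d" "exec r A B (k (f (party w A B))) R c v"
  shows "exec r A B (announce w f k) (Suc R) (d + c) v"
  by (rule exec_Message[OF refl]) (use assms in auto)

lemma exec_mono:
  assumes "exec r A B T R c v" "R \<le> R'" "c \<le> c'"
  shows "exec r A B T R' c' v"
  using assms
proof (induction arbitrary: R' c')
  case (exec_Message m g w J d k R c v)
  have "exec r A B (Message w J g k) (Suc (R' - 1)) (d + (c' - d)) v"
  proof (rule exec.exec_Message[where m = m])
    show "exec r A B (k m) (R' - 1) (c' - d) v"
      by (rule exec_Message.IH) (use exec_Message.prems in auto)
  qed (rule exec_Message.hyps)+
  then show ?case using exec_Message.prems by simp
qed (rule exec_Output)

text \<open>A message of the search carries two hashes of eight bits; the maximum makes its encoded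
  length a constant.\<close>

definition hash_bits :: nat where
  "hash_bits = Max ((\<lambda>bs. length (code (to_nat bs))) ` {bs :: bool list. length bs \<le> 16})"

lemma length_code_hash: "length bs \<le> 16 \<Longrightarrow> length (code (to_nat (bs :: bool list))) \<le> hash_bits"
  unfolding hash_bits_def
  using finite_lists_length_le[of "UNIV :: bool set" 16] by (intro Max_ge) auto

lemma length_code_le_2:
  "length (code 0) = 1" "length (code (Suc 0)) = 3" "length (code 2) = 5"
  by (simp_all add: code_0 code_pos)

definition next_checkpoint_hash :: "bool \<Rightarrow> nat \<Rightarrow> nat \<Rightarrow> nat list \<Rightarrow> 'a::finite list \<Rightarrow> nat list" where
  "next_checkpoint_hash w n t st X =
     hash_coords (Suc t) (checkpoint w X (low st)) @ hash_coords (Suc t) (checkpoint w X (mid n st))"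

text \<open>\<open>k\<close> steps are left and \<open>t\<close> are done. The stack depends on the
  transcript only, so both parties know which indices to hash.\<close>

primrec search :: "(nat \<Rightarrow> 'a::finite ptree) \<Rightarrow> nat \<Rightarrow> nat \<Rightarrow> nat \<Rightarrow> nat list \<Rightarrow> 'a ptree" where
  "search F n 0 t st = F (low st)"
| "search F n (Suc k) t st =
     Message True (next_checkpoint_hash True n t st) (\<lambda>_. to_nat) (\<lambda>m.
       Message False (next_checkpoint_hash False n t st)
         (\<lambda>_ bs. let bs' = from_nat m in verdict (take 8 bs' = take 8 bs) (drop 8 bs' = drop 8 bs))
         (\<lambda>y. search F n k (Suc t) (refine n st y)))"

lemma exec_search:
  assumes "exec r A B (F (low (hash_walk r n (checkpoint True A) (checkpoint False B) (t + k)))) R c v"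
  shows "exec r A B (search F n k t (hash_walk r n (checkpoint True A) (checkpoint False B) t))
           (2 * k + R) (k * (hash_bits + 5) + c) v"
  using assms
proof (induction k arbitrary: t)
  case (Suc k)
  let ?x = "checkpoint True A" and ?y = "checkpoint False B"
  let ?st = "hash_walk r n ?x ?y t"
  let ?a = "map r (next_checkpoint_hash True n t ?st A)"
  let ?b = "map r (next_checkpoint_hash False n t ?st B)"
  let ?v = "let bs' = from_nat (to_nat ?a) in verdict (take 8 bs' = take 8 ?b) (drop 8 bs' = drop 8 ?b)"
  have v: "?v = verdict (fst (flags r n ?x ?y t ?st)) (snd (flags r n ?x ?y t ?st))"
    by (simp add: next_checkpoint_hash_def flags_def collide_def Let_def)
  have "exec r A B (search F n k (Suc t) (hash_walk r n ?x ?y (Suc t))) (2 * k + R)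
    (k * (hash_bits + 5) + c) v"
    using Suc.prems by (intro Suc.IH) simp
  then have IH: "exec r A B (search F n k (Suc t) (refine n ?st ?v)) (2 * k + R)
    (k * (hash_bits + 5) + c) v"
    unfolding v by (simp add: Let_def)
  have "exec r A B (search F n (Suc k) t ?st) (Suc (Suc (2 * k + R)))
    (hash_bits + (5 + (k * (hash_bits + 5) + c))) v"
    unfolding search.simps
  proof (rule exec_Message[where m = "to_nat ?a"])
    show "length (code (to_nat ?a)) \<le> hash_bits"
      by (rule length_code_hash) (simp add: next_checkpoint_hash_def)
    show "exec r A B (Message False (next_checkpoint_hash False n t ?st)
         (\<lambda>_ bs. let bs' = from_nat (to_nat ?a) in verdict (take 8 bs' = take 8 bs) (drop 8 bs' = drop 8 bs))
         (\<lambda>y. search F n k (Suc t) (refine n ?st y))) (Suc (2 * k + R)) (5 + (k * (hash_bits + 5) + c)) v"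
      by (rule exec_Message[where m = ?v]) (use IH in \<open>simp_all add: Let_def verdict_def length_code_le_2\<close>)
  qed simp
  then show ?case by (rule exec_mono) simp_all
qed simp

section \<open>An upper bound by repeated doubling\<close>

text \<open>The argument \<open>h\<close> is the hash received from Alice, if it is Bob's turn.\<close>
primcorec guess :: "(nat \<Rightarrow> 'a::finite ptree) \<Rightarrow> nat \<Rightarrow> nat option \<Rightarrow> 'a ptree" where
  "guess F n h = Message (h = None) (\<lambda>X. hash_coords 0 (checkpoint (h = None) X (2 ^ n)))
     (\<lambda>_ bs. case h of None \<Rightarrow> to_nat bs | Some m \<Rightarrow> if bs = from_nat m then 1 else 0)
     (\<lambda>y. if h = None then guess F n (Some y)
           else if y = 1 then guess F (Suc n) None else F n)"

lemma exec_guess_step: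
  assumes "exec r A B (if collide r 0 (checkpoint True A (2 ^ n)) (checkpoint False B (2 ^ n))
             then guess F (Suc n) None else F n) R c v"
  shows "exec r A B (guess F n None) (2 + R) (hash_bits + 3 + c) v"
proof -
  let ?a = "map r (hash_coords 0 (checkpoint True A (2 ^ n)))"
  have "exec r A B (guess F n (Some (to_nat ?a))) (Suc R) (3 + c) v"
    by (subst guess.code, rule exec_Message[OF refl])
      (use assms in \<open>auto simp: length_code_le_2 collide_def\<close>)
  then have "exec r A B (guess F n None) (Suc (Suc R)) (hash_bits + (3 + c)) v"
    by (subst guess.code, intro exec_Message[where m = "to_nat ?a"])
      (auto intro!: length_code_hash)
  then show ?thesis by (rule exec_mono) simp_all
qed

text \<open>Induction on the distance \<open>k\<close> to the exponent \<open>N\<close> where the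
  doubling stops: below it the checkpoints and hence their hashes agree, at it the hashes differ by
  assumption.\<close>

lemma exec_guess:
  assumes eq: "\<And>j. j \<le> q \<Longrightarrow> checkpoint True A j = checkpoint False B j"
    and nc: "\<not> collide r 0 (checkpoint True A (2 ^ N)) (checkpoint False B (2 ^ N))"
    and small: "\<And>n. n < N \<Longrightarrow> 2 ^ n \<le> q"
    and F: "exec r A B (F N) R c v"
  shows "k \<le> N \<Longrightarrow> exec r A B (guess F (N - k) None) (2 * Suc k + R) (Suc k * (hash_bits + 3) + c) v"
proof (induction k)
  case 0
  then show ?case using exec_guess_step[of r A B N F R c v] nc F by simp
next
  case (Suc k)
  then have "checkpoint True A (2 ^ (N - Suc k)) = checkpoint False B (2 ^ (N - Suc k))"
    by (intro eq small) simp
  then have "exec r A B (guess F (N - Suc k) None) (2 + (2 * Suc k + R))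
      (hash_bits + 3 + (Suc k * (hash_bits + 3) + c)) v"
    using Suc by (intro exec_guess_step) (simp add: Suc_diff_Suc)
  then show ?case by (rule exec_mono) simp_all
qed

section \<open>The common part of both protocols and its success probability\<close>

definition protocol_tree :: "(nat \<Rightarrow> 'a::finite ptree) \<Rightarrow> 'a ptree" where
  "protocol_tree F = guess (\<lambda>n. search F n (3 * n) 0 []) 0 None"

lemma power_le_of_less_floorlog: "n < floorlog 2 q \<Longrightarrow> 2 ^ n \<le> q"
  using floorlog_geD[of "Suc n" 2 q] by simp

lemma less_power_floorlog: "q < 2 ^ floorlog 2 q"
  by (rule floorlog_leD) simp_all

text \<open>The failures are a bad search (at most 1/4) and a collision at \<open>2 ^ N\<close> (at
  most 1/16); the remaining 11/16 exceeds 2/3.\<close>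

lemma protocol_tree_success:
  fixes A B :: "'a::finite list"
  assumes q: "\<And>j. checkpoint True A j = checkpoint False B j \<longleftrightarrow> j \<le> q"
    and F: "\<And>r. exec r A B (F q) R c v"
  defines "N \<equiv> floorlog 2 q"
  assumes R': "real (8 * N + 2 + R) \<le> R'" and c': "real ((4 * N + 1) * (hash_bits + 5) + c) \<le> c'"
  shows "measure coins {r \<in> space coins. run_ok (compile (protocol_tree F)) A B r R' c' v} \<ge> 2/3"
proof -
  let ?x = "checkpoint True A" and ?y = "checkpoint False B"
  obtain E where E: "E \<in> sets coins" "measure coins E \<le> 1/4"
    "\<And>r. r \<notin> E \<Longrightarrow> low (hash_walk r N ?x ?y (3 * N)) = q"
    using hash_walk_failure[OF q less_power_floorlog] unfolding N_def by blast
  define E' where "E' = {r. collide r 0 (?x (2 ^ N)) (?y (2 ^ N))}"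
  have E'_sets: "E' \<in> sets coins"
    using collide_measurable[of 0 "?x (2 ^ N)" "?y (2 ^ N)"] by (simp add: E'_def pred_def)
  have "q < 2 ^ N" unfolding N_def by (rule less_power_floorlog)
  then have "?x (2 ^ N) \<noteq> ?y (2 ^ N)" using q[of "2 ^ N"] by simp
  then have "measure coins E' \<le> (1/2) ^ 8"
    using measure_collide[of "{0}" "\<lambda>_. ?x (2 ^ N)" "\<lambda>_. ?y (2 ^ N)"] by (simp add: E'_def)
  also have "(1/2::real) ^ 8 \<le> 1/16" by (simp add: power_divide)
  finally have E'_measure: "measure coins E' \<le> 1/16" .
  let ?S = "{r \<in> space coins. run_ok (compile (protocol_tree F)) A B r R' c' v}"
  have "- (E \<union> E') \<subseteq> ?S"
  proof
    fix r assume r: "r \<in> - (E \<union> E')"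
    have "exec r A B (F (low (hash_walk r N ?x ?y (0 + 3 * N)))) R c v"
      using F E(3)[of r] r by simp
    then have "exec r A B (search F N (3 * N) 0 (hash_walk r N ?x ?y 0)) (2 * (3 * N) + R)
        (3 * N * (hash_bits + 5) + c) v"
      by (rule exec_search)
    then have "exec r A B (guess (\<lambda>n. search F n (3 * n) 0 []) (N - N) None)
        (2 * Suc N + (2 * (3 * N) + R)) (Suc N * (hash_bits + 3) + (3 * N * (hash_bits + 5) + c)) v"
      using r q power_le_of_less_floorlog[of _ q]
      by (intro exec_guess[where q = q]) (auto simp: E'_def N_def)
    then have "exec r A B (protocol_tree F) (8 * N + 2 + R) ((4 * N + 1) * (hash_bits + 5) + c) v"
      unfolding protocol_tree_def diff_self_eq_0 by (rule exec_mono) (simp_all add: algebra_simps)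
    then show "r \<in> ?S" using R' c' by (simp add: run_ok_compile)
  qed
  then have "measure coins (- (E \<union> E')) \<le> measure coins ?S"
    by (rule coins.finite_measure_mono) (rule run_ok_measurable)
  moreover have "measure coins (- (E \<union> E')) = 1 - measure coins (E \<union> E')"
    using coins.prob_compl[of "E \<union> E'"] E(1) E'_sets by (simp add: Compl_eq_Diff_UNIV)
  moreover have "measure coins (E \<union> E') \<le> measure coins E + measure coins E'"
    by (rule measure_Un_le) (use E(1) E'_sets in auto)
  ultimately show ?thesis using E(2) E'_measure by linarith
qed

section \<open>Inside the first differing phrase\<close>

definition match_length :: "nat \<Rightarrow> nat \<Rightarrow> 'a list \<Rightarrow> nat" where
  "match_length q s X = self_match X (checkpoint_pos X q) s"

definition match_symbol :: "nat \<Rightarrow> nat \<Rightarrow> 'a list \<Rightarrow> 'a option" where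
  "match_symbol q s X = symbol_at X (checkpoint_pos X q + match_length q s X)"

text \<open>Lengths of equal level have binary lengths within a factor of two, which is precise
  enough for choosing the party that announces its length.\<close>

definition match_level :: "nat \<Rightarrow> nat \<Rightarrow> 'a list \<Rightarrow> nat" where
  "match_level q s X = floorlog 2 (floorlog 2 (match_length q s X))"

text \<open>\<open>w\<close> is meant to be a party of minimal level, which need not have the
  shorter match; the other party then knows both matches and states the answer.\<close>

definition conclude :: "bool \<Rightarrow> nat \<Rightarrow> nat \<Rightarrow> 'a::finite ptree" where
  "conclude w q s = announce w (match_length q s) (\<lambda>M.
     announce w (\<lambda>X. to_nat (match_symbol q s X)) (\<lambda>a.
       announce (\<not> w) (\<lambda>X. match_end (checkpoint_pos X q) M (from_nat a)
                             (match_length q s X) (match_symbol q s X)) Output))"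

definition symbol_bits :: "'a::finite itself \<Rightarrow> nat" where
  "symbol_bits _ = Max (range (\<lambda>a :: 'a option. length (code (to_nat a))))"

lemma length_code_symbol:
  "length (code (to_nat (a :: 'a::finite option))) \<le> symbol_bits TYPE('a)"
  unfolding symbol_bits_def by (rule Max_ge) auto

lemma party_not: "party (\<not> w) a b = party w b a"
  by (simp add: party_def)

text \<open>With \<open>e\<close> the level of \<open>N\<close>,
  \<open>floorlog 2 M < 2 ^ e \<le> 2 * floorlog 2 N\<close>.\<close>

lemma floorlog_le_twice:
  assumes "floorlog 2 (floorlog 2 M) \<le> floorlog 2 (floorlog 2 N)"
  shows "floorlog 2 M \<le> 2 * floorlog 2 N"
proof (cases "floorlog 2 N = 0")
  case True
  then show ?thesis using assms by (simp add: floorlog_eq_zero_iff floorlog_def[of 2 0])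
next
  case False
  define e where "e = floorlog 2 (floorlog 2 N)"
  have "0 < e" using False by (simp add: e_def floorlog_def)
  have "2 ^ (e - 1) \<le> floorlog 2 N"
    by (rule floorlog_geD) (use \<open>0 < e\<close> in \<open>auto simp: e_def\<close>)
  moreover have "floorlog 2 M < 2 ^ e"
    by (rule floorlog_leD) (use assms in \<open>auto simp: e_def\<close>)
  moreover have "(2::nat) ^ e = 2 * 2 ^ (e - 1)" using \<open>0 < e\<close> by (cases e) auto
  ultimately show ?thesis by linarith
qed

locale final_phase =
  fixes A B :: "'a::finite list" and q :: nat
  assumes last_equal: "\<And>j. checkpoint True A j = checkpoint False B j \<longleftrightarrow> j \<le> q"
    and num_phrases_le: "lz77_num_phrases (take (lcp A B) A) \<le> q"
begin

definition s where "s = source A (checkpoint_pos A q)"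

lemma pos: "checkpoint_pos A q = checkpoint_pos B q" "checkpoint_pos A q \<le> lcp A B"
  using checkpoint_eqD[of A q B] last_equal by auto

text \<open>Bounds the cost of sending Alice's source by \<open>O(lg l)\<close> bits.\<close>

lemma s_le: "s \<le> lcp A B"
  using lcp_le_self_match(2)[OF last_equal num_phrases_le] pos(2) by (simp add: s_def)

lemma result: "match_end (checkpoint_pos (party w B A) q) (match_length q s (party w A B)) (match_symbol q s (party w A B))
    (match_length q s (party w B A)) (match_symbol q s (party w B A)) = lcp A B"
proof -
  have "(lcp A B) = match_end (checkpoint_pos A q) (match_length q s A) (match_symbol q s A)
     (match_length q s B) (match_symbol q s B)"
    using lcp_eq_match_end[OF pos(2), of s] lcp_le_self_match(1)[OF last_equal num_phrases_le]
    by (simp add: s_def match_length_def match_symbol_def pos(1))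
  then show ?thesis
    by (cases w) (simp_all add: pos(1) match_end_commute[of _ "match_length q s B"])
qed

lemma min_le: "min (match_length q s A) (match_length q s B) \<le> lcp A B"
  using lcp_ge_self_match[OF pos(2), of s] by (simp add: match_length_def pos(1))

lemma min_level: "min (match_level q s A) (match_level q s B) \<le> floorlog 2 (floorlog 2 (lcp A B))"
  using min_le floorlog_mono[of _ "lcp A B" 2, THEN floorlog_mono[of _ _ 2]]
  by (auto simp: match_level_def min_le_iff_disj)

text \<open>One of the two match lengths is at most \<open>lcp A B\<close>; if it is the other
  party's, the levels still bound the speaker's binary length by twice that one's.\<close>

lemma exec_conclude:
  assumes "match_level q s (party w A B) \<le> match_level q s (party w B A)"
  shows "exec r A B (conclude w q s) 3 (6 * floorlog 2 (lcp A B) + 2 + symbol_bits TYPE('a)) (lcp A B)"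
proof -
  let ?M = "match_length q s (party w A B)" and ?N = "match_length q s (party w B A)"
  have "min ?M ?N \<le> lcp A B" using min_le by (cases w) (auto simp: min.commute)
  then have "floorlog 2 ?M \<le> floorlog 2 (lcp A B) \<or> floorlog 2 ?N \<le> floorlog 2 (lcp A B)"
    by (auto simp: min_le_iff_disj intro: floorlog_mono)
  then have M: "floorlog 2 ?M \<le> 2 * floorlog 2 (lcp A B)"
    using floorlog_le_twice[of ?M ?N] assms by (auto simp: match_level_def)
  have "exec r A B (conclude w q s) (Suc (Suc (Suc 0)))
     ((4 * floorlog 2 (lcp A B) + 1) + (symbol_bits TYPE('a) + ((2 * floorlog 2 (lcp A B) + 1) + 0))) (lcp A B)"
    unfolding conclude_def
    by (intro exec_announce)
      (use M in \<open>auto simp: length_code[of "match_length _ _ _"] length_code[of "lcp A B"] length_code_symbol party_not result intro: exec_Output\<close>)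
  then show ?thesis by (rule exec_mono) simp_all
qed

end

section \<open>Two ways to find a party of minimal level\<close>

definition finish_direct :: "nat \<Rightarrow> 'a::finite ptree" where
  "finish_direct q = announce True (\<lambda>A. source A (checkpoint_pos A q)) (\<lambda>s.
     announce True (match_level q s) (\<lambda>e.
       announce False (\<lambda>B. if e \<le> match_level q s B then 1 else 0) (\<lambda>y.
         conclude (y = 1) q s)))"

text \<open>A unary search: the number of messages is governed by the smaller level, which is
  \<open>O(lg lg l)\<close>, however large the other level is.\<close>

primcorec race :: "nat \<Rightarrow> nat \<Rightarrow> bool \<Rightarrow> nat \<Rightarrow> 'a::finite ptree" where
  "race q s w i = Message w (\<lambda>_. []) (\<lambda>X _. if match_level q s X \<le> i then 1 else 0)
     (\<lambda>y. if y = 1 then conclude w q s else race q s (\<not> w) (if w then i else Suc i))"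

definition finish_race :: "nat \<Rightarrow> 'a::finite ptree" where
  "finish_race q = announce True (\<lambda>A. source A (checkpoint_pos A q)) (\<lambda>s. race q s True 0)"

context final_phase
begin

text \<open>Alice's level is doubly logarithmic in a length up to \<open>length A\<close>, so naming
  it in one message takes \<open>O(lg lg lg |A|)\<close> bits.\<close>

lemma exec_finish_direct:
  "exec r A B (finish_direct q) 6
     (8 * floorlog 2 (lcp A B) + 2 * floorlog 2 (floorlog 2 (floorlog 2 (length A))) + 7 + symbol_bits TYPE('a)) (lcp A B)"
proof -
  have "match_length q s A \<le> length A"
    using self_match_cases[of A "checkpoint_pos A q" s] by (auto simp: match_length_def)
  then have e: "floorlog 2 (match_level q s A) \<le> floorlog 2 (floorlog 2 (floorlog 2 (length A)))"
    unfolding match_level_def by (intro floorlog_mono)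
  define w where "w = (match_level q s A \<le> match_level q s B)"
  have fin: "exec r A B (conclude w q s) 3 (6 * floorlog 2 (lcp A B) + 2 + symbol_bits TYPE('a)) (lcp A B)"
    by (rule exec_conclude) (cases w; auto simp: w_def)
  have "exec r A B (finish_direct q) (Suc (Suc (Suc 3)))
     ((2 * floorlog 2 (lcp A B) + 1) + ((2 * floorlog 2 (floorlog 2 (floorlog 2 (length A))) + 1) +
       (3 + (6 * floorlog 2 (lcp A B) + 2 + symbol_bits TYPE('a))))) (lcp A B)"
    unfolding finish_direct_def
    by (intro exec_announce)
      (use e fin floorlog_mono[OF s_le, of 2] in
        \<open>auto simp: length_code[of s] length_code[of "match_level _ _ _"] length_code_le_2 w_def s_def[symmetric]\<close>)
  then show ?thesis by (rule exec_mono) simp_all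
qed

text \<open>Induction on the number \<open>k\<close> of increments left. At threshold
  \<open>m\<close> Alice stops the race if her level is minimal, and otherwise Bob does so one
  message later.\<close>

lemma exec_race:
  fixes i :: nat
  defines "m \<equiv> min (match_level q s A) (match_level q s B)"
  assumes "k \<le> m"
  shows "exec r A B (race q s True (m - k)) (2 * Suc k + 3)
     (6 * Suc k + (6 * floorlog 2 (lcp A B) + 2 + symbol_bits TYPE('a))) (lcp A B)"
  using assms(2)
proof (induction k)
  case 0
  let ?c = "6 * floorlog 2 (lcp A B) + 2 + symbol_bits TYPE('a)"
  show ?case
  proof (cases "match_level q s A \<le> match_level q s B")
    case True
    then have "exec r A B (race q s True m) (Suc 3) (3 + ?c) (lcp A B)"
      using exec_conclude[of True r]
      by (subst race.code, intro exec_announce) (auto simp: length_code_le_2 m_def)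
    then show ?thesis unfolding diff_zero by (rule exec_mono) simp_all
  next
    case False
    then have "exec r A B (race q s False m) (Suc 3) (3 + ?c) (lcp A B)"
      using exec_conclude[of False r]
      by (subst race.code, intro exec_announce) (auto simp: length_code_le_2 m_def)
    then have "exec r A B (race q s True m) (Suc (Suc 3)) (3 + (3 + ?c)) (lcp A B)"
      using False
      by (subst race.code, intro exec_announce) (auto simp: length_code_le_2 m_def)
    then show ?thesis unfolding diff_zero by (rule exec_mono) simp_all
  qed
next
  case (Suc k)
  let ?R = "2 * Suc k + 3" and ?c = "6 * Suc k + (6 * floorlog 2 (lcp A B) + 2 + symbol_bits TYPE('a))"
  have lt: "m - Suc k < match_level q s A" "m - Suc k < match_level q s B"
    using Suc.prems by (auto simp: m_def)
  have "exec r A B (race q s True (m - k)) ?R ?c (lcp A B)" using Suc by simp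
  then have "exec r A B (race q s False (m - Suc k)) (Suc ?R) (3 + ?c) (lcp A B)"
    using lt Suc.prems
    by (subst race.code, intro exec_announce) (auto simp: length_code_le_2 Suc_diff_Suc)
  then have "exec r A B (race q s True (m - Suc k)) (Suc (Suc ?R)) (3 + (3 + ?c)) (lcp A B)"
    using lt by (subst race.code, intro exec_announce) (auto simp: length_code_le_2)
  then show ?case by (rule exec_mono) simp_all
qed

lemma exec_finish_race:
  "exec r A B (finish_race q) (2 * floorlog 2 (floorlog 2 (lcp A B)) + 6)
     (8 * floorlog 2 (lcp A B) + 6 * floorlog 2 (floorlog 2 (lcp A B)) + 9 + symbol_bits TYPE('a)) (lcp A B)"
proof -
  define m where "m = min (match_level q s A) (match_level q s B)"
  have race: "exec r A B (race q s True 0) (2 * Suc m + 3)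
     (6 * Suc m + (6 * floorlog 2 (lcp A B) + 2 + symbol_bits TYPE('a))) (lcp A B)"
    using exec_race[of m r] by (simp add: m_def)
  have "exec r A B (finish_race q) (Suc (2 * Suc m + 3)) ((2 * floorlog 2 (lcp A B) + 1) +
     (6 * Suc m + (6 * floorlog 2 (lcp A B) + 2 + symbol_bits TYPE('a)))) (lcp A B)"
    unfolding finish_race_def
    by (intro exec_announce)
      (use race floorlog_mono[OF s_le, of 2] in \<open>auto simp: length_code s_def[symmetric]\<close>)
  then show ?thesis by (rule exec_mono) (use min_level in \<open>simp_all add: m_def\<close>)
qed

end

section \<open>Cost bounds\<close>

text \<open>The shift keeps the logarithm at least 1 for nonnegative arguments, so additive
  constants are absorbed by the factor.\<close>

definition lg2 :: "real \<Rightarrow> real" where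
  "lg2 x = log 2 (x + 2)"

lemma lg2_ge_1: "0 \<le> x \<Longrightarrow> 1 \<le> lg2 x"
  by (simp add: lg2_def le_log_iff)

lemma lg2_mono: "0 \<le> x \<Longrightarrow> x \<le> y \<Longrightarrow> lg2 x \<le> lg2 y"
  by (simp add: lg2_def)

text \<open>The slack 1 in the hypothesis has the form of the conclusion, so the bound can be
  iterated.\<close>

lemma floorlog_le_lg2:
  assumes "real n \<le> y + 1" "0 \<le> y"
  shows "real (floorlog 2 n) \<le> lg2 y + 1"
proof (cases "n = 0")
  case True
  then show ?thesis using lg2_ge_1[OF assms(2)] by (simp add: floorlog_def)
next
  case False
  have "real (floorlog 2 n) = real_of_int \<lfloor>log 2 (real n)\<rfloor> + 1"
    using False by (simp add: floorlog_def)
  also have "\<dots> \<le> log 2 (real n) + 1" by simp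
  also have "log 2 (real n) \<le> lg2 y" using False assms by (simp add: lg2_def)
  finally show ?thesis by simp
qed

lemma floorlog_floorlog_le_lg2:
  "real (floorlog 2 (floorlog 2 n)) \<le> 2 * lg2 (lg2 (real n))"
  "real (floorlog 2 (floorlog 2 (floorlog 2 n))) \<le> 2 * lg2 (lg2 (lg2 (real n)))"
proof -
  have 1: "1 \<le> lg2 (real n)" by (simp add: lg2_ge_1)
  then have 2: "1 \<le> lg2 (lg2 (real n))" by (intro lg2_ge_1) simp
  then have 3: "1 \<le> lg2 (lg2 (lg2 (real n)))" by (intro lg2_ge_1) simp
  have a: "real (floorlog 2 n) \<le> lg2 (real n) + 1" by (rule floorlog_le_lg2) simp_all
  have b: "real (floorlog 2 (floorlog 2 n)) \<le> lg2 (lg2 (real n)) + 1"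
    using a 1 by (intro floorlog_le_lg2) simp_all
  have c: "real (floorlog 2 (floorlog 2 (floorlog 2 n))) \<le> lg2 (lg2 (lg2 (real n))) + 1"
    using b 1 2 by (intro floorlog_le_lg2) simp_all
  show "real (floorlog 2 (floorlog 2 n)) \<le> 2 * lg2 (lg2 (real n))"
    "real (floorlog 2 (floorlog 2 (floorlog 2 n))) \<le> 2 * lg2 (lg2 (lg2 (real n)))"
    using b c 2 3 by linarith+
qed

locale protocol_bounds =
  fixes A B :: "'a::finite list" and l z q N :: nat
  assumes l_def: "l = lcp A B" and z_def: "z = lz77_num_phrases (take l A)"
    and q_le: "q \<le> Suc z" and N_eq: "N = floorlog 2 q"
begin

lemma N_le: "real N \<le> lg2 (real z) + 1"
  unfolding N_eq using q_le by (intro floorlog_le_lg2) simp_all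

text \<open>Lets the bits of the search, \<open>O(lg z)\<close>, be counted as
  \<open>O(lg l)\<close>.\<close>

lemma z_le_l: "z \<le> l"
  using lz77_num_phrases_le[of "take l A"] by (simp add: z_def)

lemma lg2_z: "1 \<le> lg2 (real z)" "lg2 (real z) \<le> lg2 (real l)"
  using z_le_l by (auto intro: lg2_ge_1 lg2_mono)

lemma floorlog_l: "real (floorlog 2 l) \<le> 2 * lg2 (real l)"
  using floorlog_le_lg2[of l "real l"] lg2_z by simp

lemma hash_cost:
  "real ((4 * N + 1) * (hash_bits + 5)) \<le> (9 * real hash_bits + 45) * lg2 (real l)"
proof -
  \<comment> \<open>The 9 is \<open>4 + 4 + 1\<close>, from \<open>4 * (lg2 z + 1) + 1\<close> with
    each constant bounded by a multiple of \<open>lg2 l\<close>.\<close>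
  have "real (4 * N + 1) \<le> 9 * lg2 (real l)" using N_le lg2_z by simp
  then have "real (4 * N + 1) * real (hash_bits + 5) \<le> 9 * lg2 (real l) * real (hash_bits + 5)"
    by (rule mult_right_mono) simp
  then show ?thesis by (simp only: of_nat_mult) (simp add: algebra_simps)
qed

lemma symbol_cost: "real (symbol_bits TYPE('a)) \<le> real (symbol_bits TYPE('a)) * lg2 (real l)"
  using lg2_z by (simp add: mult_le_cancel_left1)

end

text \<open>The 100 covers the remaining constants of both protocols; the communication of the race
  takes \<open>45 + 16 + 12 + 9\<close> of it.\<close>

definition cost_factor :: "'a::finite itself \<Rightarrow> real" where
  "cost_factor a = 9 * real hash_bits + real (symbol_bits a) + 100"

lemma race_success:
  fixes A B :: "'a::finite list"
  defines "l \<equiv> lcp A B" and "C \<equiv> cost_factor TYPE('a)"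
  defines "z \<equiv> lz77_num_phrases (take l A)"
  shows "measure coins {r \<in> space coins. run_ok (compile (protocol_tree finish_race)) A B r
           (C * (lg2 (real z) + lg2 (lg2 (real l)))) (C * lg2 (real l)) l} \<ge> 2/3"
proof -
  obtain q where last: "q \<le> Suc z" "\<And>j. checkpoint True A j = checkpoint False B j \<longleftrightarrow> j \<le> q" "z \<le> q"
    using checkpoint_last_equal[of A B] unfolding z_def l_def by blast
  interpret final_phase A B q by unfold_locales (use last in \<open>auto simp: z_def l_def\<close>)
  define N where "N = floorlog 2 q"
  interpret protocol_bounds A B l z q N
    by unfold_locales (simp_all add: z_def l_def N_def last(1)[unfolded z_def l_def])
  have LL: "1 \<le> lg2 (lg2 (real l))" using lg2_z by (intro lg2_ge_1) simp
  have "floorlog 2 (floorlog 2 l) \<le> floorlog 2 l"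
    by (rule floorlog_leI) simp_all
  then have ll: "real (floorlog 2 (floorlog 2 l)) \<le> 2 * lg2 (real l)" using floorlog_l by linarith
  have "real (8 * N + 2 + (2 * floorlog 2 (floorlog 2 l) + 6)) \<le> 24 * (lg2 (real z) + lg2 (lg2 (real l)))"
    using N_le lg2_z LL floorlog_floorlog_le_lg2(1)[of l] by simp
  also have "\<dots> \<le> C * (lg2 (real z) + lg2 (lg2 (real l)))"
    using lg2_z LL by (intro mult_right_mono) (simp_all add: C_def cost_factor_def)
  finally have R: "real (8 * N + 2 + (2 * floorlog 2 (floorlog 2 l) + 6)) \<le> C * (lg2 (real z) + lg2 (lg2 (real l)))" .
  have c: "real ((4 * N + 1) * (hash_bits + 5) +
       (8 * floorlog 2 l + 6 * floorlog 2 (floorlog 2 l) + 9 + symbol_bits TYPE('a))) \<le> C * lg2 (real l)"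
    using hash_cost symbol_cost floorlog_l ll lg2_z
    by (simp only: of_nat_add C_def cost_factor_def distrib_right)
  show ?thesis
    using protocol_tree_success[where F = finish_race, OF last(2) exec_finish_race R[unfolded N_def l_def] c[unfolded N_def l_def]]
    by (simp add: l_def)
qed

lemma direct_success:
  fixes A B :: "'a::finite list"
  defines "l \<equiv> lcp A B" and "C \<equiv> cost_factor TYPE('a)"
  defines "z \<equiv> lz77_num_phrases (take l A)"
  shows "measure coins {r \<in> space coins. run_ok (compile (protocol_tree finish_direct)) A B r
           (C * lg2 (real z)) (C * (lg2 (real l) + lg2 (lg2 (lg2 (real (length A)))))) l} \<ge> 2/3"
proof -
  obtain q where last: "q \<le> Suc z" "\<And>j. checkpoint True A j = checkpoint False B j \<longleftrightarrow> j \<le> q" "z \<le> q"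
    using checkpoint_last_equal[of A B] unfolding z_def l_def by blast
  interpret final_phase A B q by unfold_locales (use last in \<open>auto simp: z_def l_def\<close>)
  define N where "N = floorlog 2 q"
  interpret protocol_bounds A B l z q N
    by unfold_locales (simp_all add: z_def l_def N_def last(1)[unfolded z_def l_def])
  let ?a = "lg2 (lg2 (lg2 (real (length A))))"
  have "1 \<le> lg2 (real (length A))" by (simp add: lg2_ge_1)
  then have "1 \<le> lg2 (lg2 (real (length A)))" by (intro lg2_ge_1) simp
  then have a: "1 \<le> ?a" by (intro lg2_ge_1) simp
  have "real (8 * N + 2 + 6) \<le> 24 * lg2 (real z)" using N_le lg2_z by simp
  also have "\<dots> \<le> C * lg2 (real z)"
    using lg2_z by (intro mult_right_mono) (simp_all add: C_def cost_factor_def)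
  finally have R: "real (8 * N + 2 + 6) \<le> C * lg2 (real z)" .
  have "real ((4 * N + 1) * (hash_bits + 5) + (8 * floorlog 2 l +
       2 * floorlog 2 (floorlog 2 (floorlog 2 (length A))) + 7 + symbol_bits TYPE('a)))
     \<le> C * lg2 (real l) + 4 * ?a"
    using hash_cost symbol_cost floorlog_l lg2_z floorlog_floorlog_le_lg2(2)[of "length A"]
    by (simp only: of_nat_add C_def cost_factor_def distrib_right)
  also have "4 * ?a \<le> C * ?a"
    using a by (intro mult_right_mono) (simp_all add: C_def cost_factor_def)
  finally have c: "real ((4 * N + 1) * (hash_bits + 5) + (8 * floorlog 2 l +
       2 * floorlog 2 (floorlog 2 (floorlog 2 (length A))) + 7 + symbol_bits TYPE('a)))
     \<le> C * (lg2 (real l) + ?a)"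
    by (simp add: distrib_left)
  show ?thesis
    using protocol_tree_success[where F = finish_direct, OF last(2) exec_finish_direct R[unfolded N_def] c[unfolded N_def l_def]]
    by (simp add: l_def)
qed

theorem theorem3:
  fixes dummy :: "'a::finite itself"
  shows
   "(\<exists>(P :: 'a protocol) \<delta> C. \<delta> > 1/2 \<and>
      (\<forall>A B :: 'a list. let l = lcp A B; z = lz77_num_phrases (take l A) in
         measure coins {r \<in> space coins.
           run_ok P A B r
             (C * (log 2 (real z + 2) + log 2 (log 2 (real l + 2) + 2)))
             (C * log 2 (real l + 2))
             l} \<ge> \<delta>))
  \<and> (\<exists>(P :: 'a protocol) \<delta> C. \<delta> > 1/2 \<and>
      (\<forall>A B :: 'a list. let l = lcp A B; z = lz77_num_phrases (take l A) in
         measure coins {r \<in> space coins.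
           run_ok P A B r
             (C * log 2 (real z + 2))
             (C * (log 2 (real l + 2) + log 2 (log 2 (log 2 (real (length A) + 2) + 2) + 2)))
             l} \<ge> \<delta>))"
proof (intro conjI)
  note race = race_success[where 'a = 'a, unfolded lg2_def]
  show "\<exists>(P :: 'a protocol) \<delta> C. \<delta> > 1/2 \<and>
      (\<forall>A B :: 'a list. let l = lcp A B; z = lz77_num_phrases (take l A) in
         measure coins {r \<in> space coins.
           run_ok P A B r
             (C * (log 2 (real z + 2) + log 2 (log 2 (real l + 2) + 2)))
             (C * log 2 (real l + 2))
             l} \<ge> \<delta>)"
    unfolding Let_def
    by (rule exI[of _ "compile (protocol_tree finish_race)"], rule exI[of _ "2/3"],
        rule exI[of _ "cost_factor TYPE('a)"], intro conjI allI race) simp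
next
  note direct = direct_success[where 'a = 'a, unfolded lg2_def]
  show "\<exists>(P :: 'a protocol) \<delta> C. \<delta> > 1/2 \<and>
      (\<forall>A B :: 'a list. let l = lcp A B; z = lz77_num_phrases (take l A) in
         measure coins {r \<in> space coins.
           run_ok P A B r
             (C * log 2 (real z + 2))
             (C * (log 2 (real l + 2) + log 2 (log 2 (log 2 (real (length A) + 2) + 2) + 2)))
             l} \<ge> \<delta>)"
    unfolding Let_def
    by (rule exI[of _ "compile (protocol_tree finish_direct)"], rule exI[of _ "2/3"],
        rule exI[of _ "cost_factor TYPE('a)"], intro conjI allI direct) simp
qed

end
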